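(* Let $B=2\pi/\sqrt{6}$ and, for integers $n\ge 0$ and $\ell\ge 0$, let $Q_1(n,\ell)=2n(3n+1)+3n\ell$ and $Q_2(n,\ell)=Q_1(n,\ell)+8n+4+2\ell$. Define $$I_M(\ell,N)=\sum_{n\ge 0}\left(e^{-\frac{BQ_1(n,\ell)}{2\sqrt{N}}}-e^{-\frac{BQ_2(n,\ell)}{2\sqrt{N}}}\right).$$ Then, uniformly for integers $0\le \ell\le \sqrt{N}(\log N)^2$, as $N\to\infty$, $$\frac{1}{p(N)}V_d\left(\ell,\,N+\frac{\ell(\ell+1)}{2}\right)=I_M(\ell,N)+O\left(N^{-1/5}\right).$$
   Context: A strongly concave composition of a nonnegative integer $n$ is a finite sequence of nonnegative integers $(a_1,\dots,a_s)$, $s\ge 1$, summing to $n$, such that for some index $k$ with $1\le k\le s$ one has $a_1>a_2>\dots>a_{k-1}>a_k<a_{k+1}<\dots<a_s$. Its rank is $s-2k+1$. $V_d(m,n)$ denotes the number of strongly concave compositions of $n$ with rank $m$. $p(n)$ is the partition function, with $p(n)=0$ for negative $n$. *)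

theory Defs
  imports "HOL-Analysis.Analysis"
begin

definition is_center :: "nat list \<Rightarrow> nat \<Rightarrow> bool" where
  "is_center xs k \<longleftrightarrow> k < length xs \<and>
     (\<forall>i. i < k \<longrightarrow> xs ! i > xs ! (i + 1)) \<and>
     (\<forall>i. k \<le> i \<and> i + 1 < length xs \<longrightarrow> xs ! i < xs ! (i + 1))"

definition strongly_concave :: "nat list \<Rightarrow> nat \<Rightarrow> bool" where
  "strongly_concave xs n \<longleftrightarrow> xs \<noteq> [] \<and> sum_list xs = n \<and> (\<exists>k. is_center xs k)"

text \<open>Rank s - 2k + 1 with 1-based centre index k; with 0-based index k0 = k - 1
  this is s - 2 k0 - 1. The centre is unique (it is the position of the minimum).\<close>
definition scc_rank :: "nat list \<Rightarrow> int" where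
  "scc_rank xs = int (length xs) - 2 * int (THE k. is_center xs k) - 1"

definition Vd :: "int \<Rightarrow> nat \<Rightarrow> nat" where
  "Vd m n = card {xs. strongly_concave xs n \<and> scc_rank xs = m}"

definition partition_count :: "nat \<Rightarrow> nat" where
  "partition_count n = card {xs :: nat list. sorted_wrt (\<ge>) xs \<and> 0 \<notin> set xs \<and> sum_list xs = n}"

definition Bconst :: real where "Bconst = 2 * pi / sqrt 6"

definition Q1 :: "nat \<Rightarrow> nat \<Rightarrow> real" where
  "Q1 n l = 2 * real n * (3 * real n + 1) + 3 * real n * real l"

definition Q2 :: "nat \<Rightarrow> nat \<Rightarrow> real" where
  "Q2 n l = Q1 n l + 8 * real n + 4 + 2 * real l"

definition IM :: "nat \<Rightarrow> nat \<Rightarrow> real" where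
  "IM l N = (\<Sum>n. exp (- Bconst * Q1 n l / (2 * sqrt (real N)))
                 - exp (- Bconst * Q2 n l / (2 * sqrt (real N))))"

end

theory Submission
  imports Defs
begin

text \<open>
  A concave composition is a triple \<open>(n, A, B)\<close> of a central part \<open>n\<close> and finite sets \<open>A, B\<close> of
  larger parts, with rank \<open>card A - card B\<close>. Sorting pairs of sets by their least element, and shifting
  \<open>A\<close> up and \<open>B\<close> down, gives two linear relations; together with the Jacobi triple product they yield
  \<open>E(l, N) = p(N) - p(N - 2l - 4) + E(l + 4, N - 3l - 8)\<close> for \<open>E(l, N) = V\<^sub>d(l, N + l(l+1)/2)\<close>, and
  iterating, \<open>E(l, N) = \<Sum>n. p(N - Q\<^sub>1(n,l)) - p(N - Q\<^sub>2(n,l))\<close> exactly.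

  With \<open>s = \<pi> / sqrt (6N)\<close>, the numbers \<open>p(m) exp (-s m)\<close> are, up to normalisation, the point masses of
  \<open>\<Sum>k. k X\<^sub>k\<close> for independent geometric \<open>X\<^sub>k\<close>. Its characteristic function \<open>\<phi>\<close> satisfies
  \<open>\<integral> \<bar>t\<bar> \<bar>\<phi>(t)\<bar> dt = O(s\<^sup>3)\<close>, which is a Lipschitz bound for the masses, and a Gaussian approximation near \<open>0\<close>
  shows that the mass at \<open>N\<close> is at least a constant times \<open>s powr (3/2)\<close>. Hence
  \<open>p(N - m) / p(N) = exp (-s m) \<rho>(m)\<close> with \<open>\<rho>(0) = 1\<close> and \<open>\<rho>\<close> Lipschitz with constant \<open>O(s powr (3/2))\<close>, so
  \<open>exp (-s m) (\<rho>(m) - 1)\<close> has total variation \<open>O(sqrt s) = O(N powr (-1/4))\<close>. The values \<open>Q\<^sub>1(n,l)\<close>, \<open>Q\<^sub>2(n,l)\<close>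
  interlace, so this total variation bounds the error.
\<close>

section \<open>Pairs of finite sets and partitions\<close>

declare of_nat_sum [simp del]

text \<open>\<open>pair_count a b j m\<close> is the coefficient of x^j q^m in the product of all 1
  + x q^k with k >= a and all 1 + q^k / x with k >= b. Weights are integers, so that subtracting a
  part never truncates; at negative weights the count is 0.\<close>

definition pair_set :: "nat \<Rightarrow> nat \<Rightarrow> int \<Rightarrow> int \<Rightarrow> (nat set \<times> nat set) set" where
  "pair_set a b j m = {(A, B). finite A \<and> finite B \<and> A \<subseteq> {a..} \<and> B \<subseteq> {b..} \<and>
     int (card A) - int (card B) = j \<and> int (\<Sum>A) + int (\<Sum>B) = m}"

definition pair_count :: "nat \<Rightarrow> nat \<Rightarrow> int \<Rightarrow> int \<Rightarrow> int" where
  "pair_count a b j m = int (card (pair_set a b j m))"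

lemma finite_pair_set: "finite (pair_set a b j m)"
proof (rule finite_subset)
  show "pair_set a b j m \<subseteq> Pow {..nat m} \<times> Pow {..nat m}"
  proof clarify
    fix A B assume "(A, B) \<in> pair_set a b j m"
    then have *: "finite A" "finite B" "int (\<Sum>A) + int (\<Sum>B) = m"
      by (auto simp: pair_set_def)
    have "x \<le> nat m" if "x \<in> A" for x
      using member_le_sum[of x A "\<lambda>x. x"] that * by simp
    moreover have "x \<le> nat m" if "x \<in> B" for x
      using member_le_sum[of x B "\<lambda>x. x"] that * by simp
    ultimately show "A \<in> Pow {..nat m} \<and> B \<in> Pow {..nat m}" by auto
  qed
qed auto

lemma pair_count_nonneg: "pair_count a b j m \<ge> 0"
  by (simp add: pair_count_def)

lemma pair_count_neg: "m < 0 \<Longrightarrow> pair_count a b j m = 0"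
  by (auto simp: pair_count_def pair_set_def card_eq_0_iff)

text \<open>Pulls out the factor 1 + x q^a: either \<open>a\<close> is not in \<open>A\<close>, or
  deleting it lowers the rank by 1 and the weight by \<open>a\<close>.\<close>

lemma pair_count_split_left:
  "pair_count a b j m = pair_count (Suc a) b j m + pair_count (Suc a) b (j - 1) (m - int a)"
proof -
  let ?X = "{p \<in> pair_set a b j m. a \<notin> fst p}" and ?Y = "{p \<in> pair_set a b j m. a \<in> fst p}"
  have "?X = pair_set (Suc a) b j m"
  proof -
    have *: "A \<subseteq> {Suc a..} \<longleftrightarrow> a \<notin> A \<and> A \<subseteq> {a..}" for A
      by (auto simp: subset_iff Suc_le_eq le_less)
    show ?thesis unfolding pair_set_def * by auto
  qed
  moreover have "bij_betw (\<lambda>(A, B). (insert a A, B)) (pair_set (Suc a) b (j - 1) (m - int a)) ?Y"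
  proof (rule bij_betw_byWitness[where f' = "\<lambda>(A, B). (A - {a}, B)"])
    have *: "a \<notin> A" if "A \<subseteq> {Suc a..}" for A using that by force
    show "\<forall>x\<in>pair_set (Suc a) b (j - 1) (m - int a).
        (case case x of (A, B) \<Rightarrow> (insert a A, B) of (A, B) \<Rightarrow> (A - {a}, B)) = x"
      using * by (simp add: pair_set_def split_beta)
    show "\<forall>x\<in>?Y. (case case x of (A, B) \<Rightarrow> (A - {a}, B) of (A, B) \<Rightarrow> (insert a A, B)) = x"
      by (auto simp: insert_absorb)
    show "(\<lambda>(A, B). (insert a A, B)) ` pair_set (Suc a) b (j - 1) (m - int a) \<subseteq> ?Y"
    proof clarify
      fix A B assume "(A, B) \<in> pair_set (Suc a) b (j - 1) (m - int a)"
      then have h: "finite A" "finite B" "A \<subseteq> {Suc a..}" "B \<subseteq> {b..}"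
        "int (card A) - int (card B) = j - 1" "int (\<Sum>A) + int (\<Sum>B) = m - int a"
        by (auto simp: pair_set_def)
      moreover have "insert a A \<subseteq> {a..}" using h by auto
      ultimately show "(insert a A, B) \<in> pair_set a b j m \<and> a \<in> fst (insert a A, B)"
        using *[OF h(3)] by (simp add: pair_set_def)
    qed
    show "(\<lambda>(A, B). (A - {a}, B)) ` ?Y \<subseteq> pair_set (Suc a) b (j - 1) (m - int a)"
    proof clarify
      fix A B assume "(A, B) \<in> pair_set a b j m" "a \<in> fst (A, B)"
      then have h: "finite A" "finite B" "A \<subseteq> {a..}" "B \<subseteq> {b..}" "a \<in> A"
        "int (card A) - int (card B) = j" "int (\<Sum>A) + int (\<Sum>B) = m"
        by (auto simp: pair_set_def)
      have "A - {a} \<subseteq> {Suc a..}" using h by (auto simp: Suc_le_eq le_less)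
      moreover have "card A = Suc (card (A - {a}))" using h by (intro card.remove)
      moreover have "\<Sum>A = a + \<Sum>(A - {a})" using h by (intro sum.remove)
      ultimately show "(A - {a}, B) \<in> pair_set (Suc a) b (j - 1) (m - int a)"
        using h by (auto simp: pair_set_def)
    qed
  qed
  then have "card (pair_set (Suc a) b (j - 1) (m - int a)) = card ?Y"
    by (rule bij_betw_same_card)
  moreover have "card (pair_set a b j m) = card ?X + card ?Y"
  proof -
    have "card (pair_set a b j m) = card (?X \<union> ?Y)" by (rule arg_cong[where f = card]) blast
    also have "card (?X \<union> ?Y) = card ?X + card ?Y"
      using finite_pair_set[of a b j m] by (intro card_Un_disjoint) auto
    finally show ?thesis .
  qed
  ultimately show ?thesis by (simp add: pair_count_def)
qed

lemma pair_count_swap: "pair_count a b j m = pair_count b a (- j) m"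
proof -
  have "bij_betw (\<lambda>(A, B). (B, A)) (pair_set a b j m) (pair_set b a (- j) m)"
    by (rule bij_betw_byWitness[where f' = "\<lambda>(A, B). (B, A)"]) (auto simp: pair_set_def)
  then show ?thesis by (simp add: pair_count_def bij_betw_same_card)
qed

lemma pair_count_split_right:
  "pair_count a b j m = pair_count a (Suc b) j m + pair_count a (Suc b) (j + 1) (m - int b)"
  using pair_count_split_left[of b a "- j" m] pair_count_swap[of a b j m]
    pair_count_swap[of a "Suc b" j m] pair_count_swap[of a "Suc b" "j + 1" "m - int b"] by simp

lemma image_Suc_pred: "A \<subseteq> {Suc a..} \<Longrightarrow> Suc ` ((\<lambda>x. x - 1) ` A) = A"
proof -
  assume "A \<subseteq> {Suc a..}"
  then have "Suc (x - 1) = x" if "x \<in> A" for x using that by force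
  then show ?thesis by (simp add: image_image cong: image_cong)
qed

lemma pred_image_Suc: "(\<lambda>x. x - 1) ` (Suc ` A) = A"
  by (simp add: image_image)

lemma sum_image_Suc: "finite A \<Longrightarrow> \<Sum>(Suc ` A) = \<Sum>A + card A"
  by (simp add: sum.reindex sum_Suc)

text \<open>The substitution of x q for x: raising every element of \<open>A\<close> by 1 and
  lowering every element of \<open>B\<close> by 1 changes the weight by
  \<open>card A - card B\<close>. The bound \<open>Suc b\<close> keeps the truncated predecessor
  invertible on \<open>B\<close>.\<close>

lemma pair_count_shift: "pair_count (Suc a) b j (m + j) = pair_count a (Suc b) j m"
proof -
  let ?f = "\<lambda>(A, B). (Suc ` A, (\<lambda>x. x - 1) ` B)" and ?g = "\<lambda>(A, B). ((\<lambda>x. x - 1) ` A, Suc ` B)"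
  have dec: "card ((\<lambda>x. x - 1) ` A) = card A \<and> \<Sum>A = \<Sum>((\<lambda>x. x - 1) ` A) + card A"
    if "finite A" "A \<subseteq> {Suc c..}" for A :: "nat set" and c
  proof -
    have "card ((\<lambda>x. x - 1) ` A) = card A"
      using card_image[OF inj_Suc, of "(\<lambda>x. x - 1) ` A"] image_Suc_pred[OF that(2)] by simp
    then show ?thesis
      using sum_image_Suc[of "(\<lambda>x. x - 1) ` A"] image_Suc_pred[OF that(2)] that(1) by simp
  qed
  have inc: "card (Suc ` A) = card A" for A by (simp add: card_image)
  have "bij_betw ?f (pair_set a (Suc b) j m) (pair_set (Suc a) b j (m + j))"
  proof (rule bij_betw_byWitness[where f' = ?g])
    show "\<forall>x\<in>pair_set a (Suc b) j m. ?g (?f x) = x"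
      using image_Suc_pred[of _ b] pred_image_Suc by (simp add: pair_set_def split_beta)
    show "\<forall>x\<in>pair_set (Suc a) b j (m + j). ?f (?g x) = x"
      using image_Suc_pred[of _ a] pred_image_Suc by (simp add: pair_set_def split_beta)
    show "?f ` pair_set a (Suc b) j m \<subseteq> pair_set (Suc a) b j (m + j)"
    proof clarify
      fix A B assume "(A, B) \<in> pair_set a (Suc b) j m"
      then have h: "finite A" "finite B" "A \<subseteq> {a..}" "B \<subseteq> {Suc b..}"
        "int (card A) - int (card B) = j" "int (\<Sum>A) + int (\<Sum>B) = m"
        by (auto simp: pair_set_def)
      have "Suc ` A \<subseteq> {Suc a..}" "(\<lambda>x. x - 1) ` B \<subseteq> {b..}" using h by force+
      then show "(Suc ` A, (\<lambda>x. x - 1) ` B) \<in> pair_set (Suc a) b j (m + j)"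
        using h dec[OF h(2,4)] sum_image_Suc[OF h(1)] inc[of A] unfolding pair_set_def by auto
    qed
    show "?g ` pair_set (Suc a) b j (m + j) \<subseteq> pair_set a (Suc b) j m"
    proof clarify
      fix A B assume "(A, B) \<in> pair_set (Suc a) b j (m + j)"
      then have h: "finite A" "finite B" "A \<subseteq> {Suc a..}" "B \<subseteq> {b..}"
        "int (card A) - int (card B) = j" "int (\<Sum>A) + int (\<Sum>B) = m + j"
        by (auto simp: pair_set_def)
      have "Suc ` B \<subseteq> {Suc b..}" "(\<lambda>x. x - 1) ` A \<subseteq> {a..}" using h by force+
      then show "((\<lambda>x. x - 1) ` A, Suc ` B) \<in> pair_set a (Suc b) j m"
        using h dec[OF h(1,3)] sum_image_Suc[OF h(2)] inc[of B] unfolding pair_set_def by auto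
    qed
  qed
  then show ?thesis by (simp add: pair_count_def bij_betw_same_card)
qed

lemma pair_count_mono_left: "pair_count (Suc a) b j m \<le> pair_count a b j m"
  using pair_count_split_left[of a b j m] pair_count_nonneg[of "Suc a" b "j - 1" "m - int a"] by simp

lemma pair_count_mono_right: "pair_count a (Suc b) j m \<le> pair_count a b j m"
  using pair_count_split_right[of a b j m] pair_count_nonneg[of a "Suc b" "j + 1" "m - int b"] by simp

lemma pair_count_antimono:
  assumes "a \<le> a'" "b \<le> b'" shows "pair_count a' b' j m \<le> pair_count a b j m"
proof -
  have "pair_count a' b' j m \<le> pair_count a b' j m"
    using assms(1)
  proof (induction a' rule: dec_induct)
    case (step c)
    then show ?case using pair_count_mono_left[of c b' j m] by simp
  qed simp
  also have "\<dots> \<le> pair_count a b j m"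
    using assms(2)
  proof (induction b' rule: dec_induct)
    case (step c)
    then show ?case using pair_count_mono_right[of a c j m] by simp
  qed simp
  finally show ?thesis .
qed

section \<open>The functional equation behind the Jacobi triple product\<close>

text \<open>After the shift, 0 is available to \<open>B\<close> instead of \<open>A\<close>. The
  part 0 has no weight, so it can be handed back, which trades the factor 1 + 1/x for 1 + x and
  raises the rank by 1.\<close>

lemma pair_count_step: "pair_count 0 1 (j + 1) (m + j) = pair_count 0 1 j m"
  using pair_count_shift[of 0 0 j m] pair_count_split_right[of 1 0 j "m + j"]
    pair_count_split_left[of 0 1 "j + 1" "m + j"] by simp

lemma pair_count_triangular:
  "pair_count 0 1 (int j) (m + int (j * (j - 1) div 2)) = pair_count 0 1 0 m"
proof (induction j)
  case (Suc j)
  have "Suc j * (Suc j - 1) div 2 = j * (j - 1) div 2 + j"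
    by (cases j) (auto simp: algebra_simps)
  then show ?case
    using Suc pair_count_step[of "int j" "m + int (j * (j - 1) div 2)"] by (simp add: algebra_simps)
qed simp

text \<open>The triangular number is 0 + 1 + ... + (j - 1), the least weight possible at rank
  \<open>j\<close>; formally, going down to rank 0 leaves a negative weight.\<close>

lemma pair_count_low_weight:
  assumes "b \<ge> 1" "w < int (j * (j - 1) div 2)"
  shows "pair_count a b (int j) w = 0"
proof -
  have "pair_count 0 1 (int j) w = 0"
    using pair_count_triangular[of j "w - int (j * (j - 1) div 2)"] assms(2) pair_count_neg by simp
  then show ?thesis
    using pair_count_antimono[of 0 a 1 b "int j" w] assms(1) pair_count_nonneg[of a b "int j" w] by simp
qed

section \<open>Partitions with bounded parts\<close>

definition bounded_partitions :: "nat \<Rightarrow> nat \<Rightarrow> nat list set" where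
  "bounded_partitions M n = {xs. sorted_wrt (\<ge>) xs \<and> set xs \<subseteq> {1..M} \<and> sum_list xs = n}"

definition bounded_partition_count :: "nat \<Rightarrow> nat \<Rightarrow> nat" where
  "bounded_partition_count M n = card (bounded_partitions M n)"

lemma finite_bounded_partitions: "finite (bounded_partitions M n)"
proof (rule finite_subset)
  show "bounded_partitions M n \<subseteq> {xs. set xs \<subseteq> {1..M} \<and> length xs \<le> n}"
  proof clarify
    fix xs assume "xs \<in> bounded_partitions M n"
    then have *: "set xs \<subseteq> {1..M}" "sum_list xs = n" by (auto simp: bounded_partitions_def)
    have "length xs \<le> sum_list xs" using *(1) by (induction xs) auto
    then show "set xs \<subseteq> {1..M} \<and> length xs \<le> n" using * by simp
  qed
  show "finite {xs. set xs \<subseteq> {1..M} \<and> length xs \<le> n}" by (rule finite_lists_length_le) simp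
qed

lemma bounded_partition_count_0: "bounded_partition_count 0 n = (if n = 0 then 1 else 0)"
proof -
  have "bounded_partitions 0 n = (if n = 0 then {[]} else {})"
    by (auto simp: bounded_partitions_def)
  then show ?thesis by (simp add: bounded_partition_count_def)
qed

text \<open>Classifies by whether the part \<open>Suc M\<close> occurs. In a nonincreasing list
  bounded by \<open>Suc M\<close> it then stands at the head, and the tail is a partition of
  \<open>n - Suc M\<close>.\<close>

lemma bounded_partition_count_Suc:
  "bounded_partition_count (Suc M) n = bounded_partition_count M n +
     (if Suc M \<le> n then bounded_partition_count (Suc M) (n - Suc M) else 0)"
proof -
  let ?P = "bounded_partitions (Suc M) n"
  let ?Y = "if Suc M \<le> n then (\<lambda>xs. Suc M # xs) ` bounded_partitions (Suc M) (n - Suc M) else {}"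
  have "?P = bounded_partitions M n \<union> ?Y"
  proof
    show "?P \<subseteq> bounded_partitions M n \<union> ?Y"
    proof
      fix xs assume xs: "xs \<in> ?P"
      show "xs \<in> bounded_partitions M n \<union> ?Y"
      proof (cases "Suc M \<in> set xs")
        case False
        have "set xs \<subseteq> {1..M}"
        proof
          fix x assume "x \<in> set xs"
          then have "x \<in> {1..Suc M}" "x \<noteq> Suc M"
            using xs False by (auto simp: bounded_partitions_def)
          then show "x \<in> {1..M}" by simp
        qed
        then show ?thesis using xs by (auto simp: bounded_partitions_def)
      next
        case True
        then obtain y ys where y: "xs = y # ys" by (cases xs) auto
        then have "Suc M \<le> y" "y \<le> Suc M" using True xs by (auto simp: bounded_partitions_def)
        then have "y = Suc M" by simp
        then have "Suc M \<le> n" "xs = Suc M # ys" "ys \<in> bounded_partitions (Suc M) (n - Suc M)"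
          using xs y by (auto simp: bounded_partitions_def)
        then show ?thesis by auto
      qed
    qed
    show "bounded_partitions M n \<union> ?Y \<subseteq> ?P"
    proof -
      have "{1..M} \<subseteq> {1..Suc M}" by auto
      then have "bounded_partitions M n \<subseteq> ?P" unfolding bounded_partitions_def by blast
      moreover have "Suc M # xs \<in> ?P" if "xs \<in> bounded_partitions (Suc M) (n - Suc M)" "Suc M \<le> n" for xs
        using that by (auto simp: bounded_partitions_def)
      ultimately show ?thesis by auto
    qed
  qed
  then have "card ?P = card (bounded_partitions M n \<union> ?Y)" by (rule arg_cong)
  also have "\<dots> = card (bounded_partitions M n) + card ?Y"
  proof (rule card_Un_disjoint)
    have "Suc M # xs \<notin> bounded_partitions M n" for xs
      by (auto simp: bounded_partitions_def)
    then show "bounded_partitions M n \<inter> ?Y = {}" by auto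
  qed (auto simp: finite_bounded_partitions)
  also have "card ?Y = (if Suc M \<le> n then bounded_partition_count (Suc M) (n - Suc M) else 0)"
    by (simp add: bounded_partition_count_def card_image)
  finally show ?thesis by (simp only: bounded_partition_count_def)
qed

lemma bounded_partition_count_eq:
  assumes "n \<le> M" shows "bounded_partition_count M n = partition_count n"
proof -
  have "set xs \<subseteq> {1..M}" if "0 \<notin> set xs" "sum_list xs = n" for xs
  proof
    fix x assume "x \<in> set xs"
    then show "x \<in> {1..M}"
      using that member_le_sum_list[of x xs] assms by (cases "x = 0") simp_all
  qed
  then show ?thesis
    unfolding bounded_partition_count_def partition_count_def bounded_partitions_def
    by (intro arg_cong[where f = card] Collect_cong) force
qed

definition int_partition_count :: "int \<Rightarrow> int" where
  "int_partition_count m = (if m < 0 then 0 else int (partition_count (nat m)))"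

text \<open>A single element of \<open>B\<close> already exceeds the weight, so \<open>B\<close> is
  empty on both sides.\<close>

lemma pair_count_right_bound_irrelevant:
  assumes "m < int b" "b \<le> b'" shows "pair_count a b' j m = pair_count a b j m"
  using assms(2)
proof (induction b' rule: dec_induct)
  case (step c)
  then show ?case using pair_count_split_right[of a c j m] pair_count_neg assms(1) by simp
qed simp

lemma pair_count_zero_zero:
  assumes "m < int b" shows "pair_count a b 0 m = (if m = 0 then 1 else 0)"
proof -
  have "pair_set a b 0 m = (if m = 0 then {({}, {})} else {})"
  proof -
    have "A = {} \<and> B = {} \<and> m = 0" if "(A, B) \<in> pair_set a b 0 m" for A B
    proof -
      have h: "finite A" "finite B" "B \<subseteq> {b..}" "card A = card B" "int (\<Sum>A) + int (\<Sum>B) = m"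
        using that by (auto simp: pair_set_def)
      have "B = {}"
      proof (rule ccontr)
        assume "B \<noteq> {}"
        then obtain x where x: "x \<in> B" by auto
        then have "x \<le> \<Sum>B" using member_le_sum[of x B "\<lambda>x. x"] h by simp
        moreover have "b \<le> x" using x h by auto
        ultimately show False using h(5) assms by linarith
      qed
      then show ?thesis using h by simp
    qed
    moreover have "({}, {}) \<in> pair_set a b 0 0" by (simp add: pair_set_def)
    ultimately show ?thesis by auto
  qed
  then show ?thesis by (simp add: pair_count_def)
qed

text \<open>For so large a \<open>b\<close> the set \<open>B\<close> is empty. Subtracting the
  staircase 0, 1, ..., j - 1 from the \<open>j\<close> elements of \<open>A\<close> leaves a
  partition of \<open>m\<close> into at most \<open>j\<close> parts, conjugate to one with parts at
  most \<open>j\<close>. Instead of building this bijection, the proof matches recursions: 0 in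
  \<open>A\<close> or not, against part \<open>j\<close> absent or present.\<close>

lemma pair_count_eq_bounded_partition_count:
  assumes "int m + int (j * (j - 1) div 2) < int b"
  shows "pair_count 0 b (int j) (int m + int (j * (j - 1) div 2)) = int (bounded_partition_count j m)"
  using assms
proof (induction "j + m" arbitrary: j m b rule: less_induct)
  case less
  show ?case
  proof (cases j)
    case 0
    then show ?thesis using less.prems pair_count_zero_zero[of "int m" b 0]
      by (simp add: bounded_partition_count_0)
  next
    case (Suc i)
    have t: "j * (j - 1) div 2 = i * (i - 1) div 2 + i"
      using Suc by (cases i) (auto simp: algebra_simps)
    let ?w = "int m + int (j * (j - 1) div 2)"
    have "pair_count 0 b (int j) ?w = pair_count 1 b (int j) ?w + pair_count 1 b (int i) ?w"
      using pair_count_split_left[of 0 b "int j" ?w] Suc by simp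
    also have "pair_count 1 b (int j) ?w = pair_count 0 b (int j) (?w - int j)"
      using pair_count_shift[of 0 b "int j" "?w - int j"] less.prems
        pair_count_right_bound_irrelevant[of "?w - int j" b "Suc b" 0 "int j"] by simp
    also have "pair_count 1 b (int i) ?w = pair_count 0 b (int i) (?w - int i)"
      using pair_count_shift[of 0 b "int i" "?w - int i"] less.prems
        pair_count_right_bound_irrelevant[of "?w - int i" b "Suc b" 0 "int i"] by simp
    also have "?w - int i = int m + int (i * (i - 1) div 2)" using t by simp
    also have "pair_count 0 b (int i) \<dots> = int (bounded_partition_count i m)"
      using less.prems t Suc by (intro less.hyps) auto
    also have "pair_count 0 b (int j) (?w - int j) =
        (if j \<le> m then int (bounded_partition_count j (m - j)) else 0)"
    proof (cases "j \<le> m")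
      case True
      then have "?w - int j = int (m - j) + int (j * (j - 1) div 2)" by simp
      moreover have "pair_count 0 b (int j) (int (m - j) + int (j * (j - 1) div 2)) =
          int (bounded_partition_count j (m - j))"
        using True less.prems Suc by (intro less.hyps) auto
      ultimately show ?thesis using True by (simp only: if_True)
    next
      case False
      then show ?thesis
        using pair_count_low_weight[of b "?w - int j" j 0] less.prems by simp
    qed
    finally show ?thesis using Suc bounded_partition_count_Suc[of i m] by simp
  qed
qed

text \<open>The constraint \<open>card A - card B = j > m\<close> leaves no weight for a nonempty \<open>B\<close>.\<close>
lemma pair_count_eq_int_partition_count: "pair_count 0 1 0 m = int_partition_count m"
proof (cases "m < 0")
  case True
  then show ?thesis by (simp add: pair_count_neg int_partition_count_def)
next
  case False
  define j where "j = Suc (nat m)"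
  define w where "w = m + int (j * (j - 1) div 2)"
  have "pair_count 0 b (int j) w = pair_count 0 1 (int j) w" if "1 \<le> b" for b
    using that
  proof (induction b rule: dec_induct)
    case (step c)
    have "Suc j * (Suc j - 1) div 2 = j * (j - 1) div 2 + j"
      by (cases j) (auto simp: algebra_simps)
    \<comment> \<open>Deleting \<open>c\<close> from \<open>B\<close> leaves rank
      \<open>j + 1\<close>, whose least weight is \<open>w - m + j = w + 1\<close>, more than what
      remains.\<close>
    then have "pair_count 0 (Suc c) (int j + 1) (w - int c) = 0"
      using pair_count_low_weight[of "Suc c" "w - int c" "Suc j" 0] False step
      by (simp add: w_def j_def algebra_simps)
    then show ?case using step pair_count_split_right[of 0 c "int j" w] by simp
  qed simp
  from this[of "nat w + 1"] have "pair_count 0 1 0 m = pair_count 0 (nat w + 1) (int j) w"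
    using pair_count_triangular[of j m] by (simp add: w_def)
  also have "\<dots> = int (bounded_partition_count j (nat m))"
    using pair_count_eq_bounded_partition_count[of "nat m" j "nat w + 1"] False by (simp add: w_def)
  also have "\<dots> = int_partition_count m"
    using False by (simp add: int_partition_count_def bounded_partition_count_eq j_def)
  finally show ?thesis .
qed

text \<open>The triple product with an extra factor 1 + 1/x, whose two terms give the two partition
  numbers.\<close>

lemma pair_count_0_0:
  "pair_count 0 0 (int j) m =
     int_partition_count (m - int (j * (j - 1) div 2)) + int_partition_count (m - int (j * (j + 1) div 2))"
proof -
  have "pair_count 0 1 (int j) m = int_partition_count (m - int (j * (j - 1) div 2))"
    using pair_count_triangular[of j "m - int (j * (j - 1) div 2)"]
    using pair_count_eq_int_partition_count by simp
  moreover have "pair_count 0 1 (int j + 1) m = int_partition_count (m - int (j * (j + 1) div 2))"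
    using pair_count_triangular[of "Suc j" "m - int (j * (j + 1) div 2)"]
    using pair_count_eq_int_partition_count by (simp add: algebra_simps)
  ultimately show ?thesis using pair_count_split_right[of 0 0 "int j" m] by simp
qed

section \<open>An exact formula for the number of concave compositions\<close>

lemma pair_count_large_parts:
  assumes "m < int a" "m < int b" "j \<noteq> 0" shows "pair_count a b j m = 0"
proof -
  have "(A, B) \<notin> pair_set a b j m" for A B
  proof
    assume "(A, B) \<in> pair_set a b j m"
    then have h: "finite A" "finite B" "A \<subseteq> {a..}" "B \<subseteq> {b..}"
        "int (card A) - int (card B) = j" "int (\<Sum>A) + int (\<Sum>B) = m"
      by (auto simp: pair_set_def)
    from h(5) assms(3) have "A \<noteq> {} \<or> B \<noteq> {}" by auto
    then show False
    proof
      assume "A \<noteq> {}"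
      then obtain x where x: "x \<in> A" by blast
      then have "x \<le> \<Sum>A" "a \<le> x" using member_le_sum[of x A "\<lambda>x. x"] h by auto
      then show False using h(6) assms(1) by linarith
    next
      assume "B \<noteq> {}"
      then obtain x where x: "x \<in> B" by blast
      then have "x \<le> \<Sum>B" "b \<le> x" using member_le_sum[of x B "\<lambda>x. x"] h by auto
      then show False using h(6) assms(2) by linarith
    qed
  qed
  then have "pair_set a b j m = {}" by auto
  then show ?thesis by (simp add: pair_count_def)
qed

text \<open>The coefficient of \<open>x\<^sup>j q\<^sup>m\<close> in \<open>\<Sum>n\<ge>0. q^(c n) \<Prod>k>n. (1 + x q^k) (1 + q^k / x)\<close>.\<close>
definition concave_sum :: "nat \<Rightarrow> int \<Rightarrow> int \<Rightarrow> int" where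
  "concave_sum c j m = (\<Sum>n\<le>nat m. pair_count (Suc n) (Suc n) j (m - int (c * n)))"

lemma concave_sum_extend:
  assumes "c \<ge> 1" "nat m \<le> R"
  shows "(\<Sum>n\<le>R. pair_count (Suc n) (Suc n) j (m - int (c * n))) = concave_sum c j m"
  unfolding concave_sum_def
proof (rule sum.mono_neutral_right)
  show "\<forall>n\<in>{..R} - {..nat m}. pair_count (Suc n) (Suc n) j (m - int (c * n)) = 0"
  proof
    fix n assume "n \<in> {..R} - {..nat m}"
    then have "m < int n" by auto
    also have "int n \<le> int (c * n)" using assms(1) by (simp only: of_nat_le_iff) simp
    finally show "pair_count (Suc n) (Suc n) j (m - int (c * n)) = 0" by (simp add: pair_count_neg)
  qed
qed (use assms in auto)

text \<open>Sort the pairs by the least element of the union of both sets.\<close>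
lemma pair_count_0_0_concave_sum:
  assumes "j \<noteq> 0"
  shows "pair_count 0 0 j m = concave_sum 1 (j + 1) m + concave_sum 1 (j - 1) m + concave_sum 2 j m"
proof -
  define R where "R = nat m"
  let ?P = "\<lambda>n. pair_count (Suc n) (Suc n)"
  \<comment> \<open>The four cases for \<open>n\<close>, in this order: in neither set, in
    \<open>B\<close> only, in \<open>A\<close> only, in both.\<close>
  have step: "pair_count n n j m = ?P n j m + (?P n (j + 1) (m - int (1 * n)) +
      ?P n (j - 1) (m - int (1 * n)) + ?P n j (m - int (2 * n)))" for n
    using pair_count_split_left[of n n j m] pair_count_split_right[of "Suc n" n j m]
      pair_count_split_right[of "Suc n" n "j - 1" "m - int n"] by (simp add: algebra_simps)
  have "pair_count 0 0 j m = ?P R j m + (\<Sum>n\<le>R. ?P n (j + 1) (m - int (1 * n)) +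
      ?P n (j - 1) (m - int (1 * n)) + ?P n j (m - int (2 * n)))" for R
  proof (induction R)
    case 0
    show ?case using step[of 0] by simp
  next
    case (Suc R)
    then show ?case using step[of "Suc R"] by simp
  qed
  from this[of R] have "pair_count 0 0 j m = ?P R j m +
     ((\<Sum>n\<le>R. ?P n (j + 1) (m - int (1 * n))) + (\<Sum>n\<le>R. ?P n (j - 1) (m - int (1 * n))) +
      (\<Sum>n\<le>R. ?P n j (m - int (2 * n))))"
    by (simp only: sum.distrib)
  \<comment> \<open>A nonzero rank forces some element to exist, and every admissible element
    exceeds \<open>m\<close>.\<close>
  moreover have "?P R j m = 0"
    using assms by (intro pair_count_large_parts) (auto simp: R_def)
  ultimately show ?thesis by (simp only: concave_sum_extend R_def order_refl one_le_numeral)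
qed

text \<open>Both sides count triples \<open>(n, A, B)\<close> with \<open>A \<subseteq> {n + 1..}\<close> and \<open>B \<subseteq> {n..}\<close>.\<close>
lemma concave_sum_shift:
  assumes "j \<ge> 0"
  shows "concave_sum 1 j m + concave_sum 2 (j - 1) m =
    concave_sum 1 j (m + j) + concave_sum 2 (j + 1) (m + j)"
proof -
  define R where "R = nat (m + j)"
  let ?P = "\<lambda>n. pair_count (Suc n) (Suc n)"
  have "?P n j (m - int (1 * n)) + ?P n (j - 1) (m - int (2 * n)) =
      ?P n j (m + j - int (1 * n)) + ?P n (j + 1) (m + j - int (2 * n))" for n
  proof -
    have "pair_count (Suc n) n j (m + j - int n) =
        ?P n j (m + j - int n) + ?P n (j + 1) (m + j - int (2 * n))"
      using pair_count_split_right[of "Suc n" n j "m + j - int n"] by (simp add: algebra_simps)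
    \<comment> \<open>The second way to count the same pairs: split on whether \<open>Suc n\<close>
      lies in \<open>A\<close>, then shift \<open>A\<close> down and \<open>B\<close> up.\<close>
    moreover have "pair_count (Suc n) n j (m + j - int n) =
        ?P n j (m - int n) + ?P n (j - 1) (m - int (2 * n))"
      using pair_count_split_left[of "Suc n" n j "m + j - int n"]
        pair_count_shift[of "Suc n" n j "m - int n"]
        pair_count_shift[of "Suc n" n "j - 1" "m - int (2 * n)"] by (simp add: algebra_simps)
    ultimately show ?thesis by simp
  qed
  then have "(\<Sum>n\<le>R. ?P n j (m - int (1 * n)) + ?P n (j - 1) (m - int (2 * n))) =
      (\<Sum>n\<le>R. ?P n j (m + j - int (1 * n)) + ?P n (j + 1) (m + j - int (2 * n)))"
    by (intro sum.cong refl)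
  then show ?thesis
    using assms concave_sum_extend[of 1 m R] concave_sum_extend[of 2 m R]
      concave_sum_extend[of 1 "m + j" R] concave_sum_extend[of 2 "m + j" R]
    by (simp add: sum.distrib R_def nat_mono)
qed

text \<open>A concave composition of rank \<open>l\<close> weighs at least 1 + ... + l, so
  \<open>N\<close> is the weight in excess of this minimum.\<close>

definition shifted_concave_count :: "nat \<Rightarrow> int \<Rightarrow> int" where
  "shifted_concave_count l N = concave_sum 1 (int l) (N + int (l * (l + 1) div 2))"

text \<open>Subtract the decompositions of \<open>pair_count 0 0\<close> at ranks
  \<open>l + 1\<close> and \<open>l + 3\<close>. By \<open>concave_sum_shift\<close> at rank
  \<open>l + 2\<close>, all terms of \<open>concave_sum 2\<close> and all terms of rank
  \<open>l + 2\<close> cancel. Of the resulting four partition numbers two are equal and cancel as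
  well.\<close>

lemma shifted_concave_count_rec:
  "shifted_concave_count l N = int_partition_count N - int_partition_count (N - int (2 * l + 4)) +
     shifted_concave_count (l + 4) (N - int (3 * l + 8))"
proof -
  define T where "T = l * (l + 1) div 2"
  define m where "m = N + int T"
  have T2: "2 * T = l * (l + 1)" by (simp add: T_def)
  have t1: "(l + 1) * (l + 1 + 1) div 2 = T + l + 1" "(l + 1) * (l + 1 - 1) div 2 = T"
    "(l + 3) * (l + 3 - 1) div 2 = T + 2 * l + 3" "(l + 3) * (l + 3 + 1) div 2 = T + 3 * l + 6"
    "(l + 4) * (l + 4 + 1) div 2 = T + 4 * l + 10"
    using T2 by (auto simp: algebra_simps T_def)
  have "concave_sum 1 (int l) m = pair_count 0 0 (int (l + 1)) m - pair_count 0 0 (int (l + 3)) (m + int (l + 2))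
      + concave_sum 1 (int (l + 4)) (m + int (l + 2))"
    using concave_sum_shift[of "int (l + 2)" m] pair_count_0_0_concave_sum[of "int (l + 1)" m]
      pair_count_0_0_concave_sum[of "int (l + 3)" "m + int (l + 2)"]
    by (simp add: algebra_simps)
  also have "pair_count 0 0 (int (l + 1)) m = int_partition_count N + int_partition_count (N - int (l + 1))"
    unfolding pair_count_0_0 t1 by (simp add: m_def algebra_simps)
  also have "pair_count 0 0 (int (l + 3)) (m + int (l + 2)) =
     int_partition_count (N - int (l + 1)) + int_partition_count (N - int (2 * l + 4))"
    unfolding pair_count_0_0 t1 by (simp add: m_def algebra_simps)
  also have "concave_sum 1 (int (l + 4)) (m + int (l + 2)) = shifted_concave_count (l + 4) (N - int (3 * l + 8))"
    unfolding shifted_concave_count_def t1 by (simp add: m_def algebra_simps)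
  finally show ?thesis by (simp add: shifted_concave_count_def m_def T_def)
qed

text \<open>Rank \<open>l\<close> with parts that are at least 1 needs weight 1 + ... + l, and a
  larger centre only restricts the two sets further.\<close>

lemma shifted_concave_count_neg:
  assumes "N < 0" shows "shifted_concave_count l N = 0"
proof -
  have "pair_count (Suc n) (Suc n) (int l) (N + int (l * (l + 1) div 2) - int (1 * n)) = 0" for n
  proof -
    let ?w = "N + int (l * (l + 1) div 2) - int (1 * n)"
    have "l * (l + 1) div 2 = l * (l - 1) div 2 + l" by (cases l) (auto simp: algebra_simps)
    then have "?w - int l < int (l * (l - 1) div 2)" using assms by simp
    then have "pair_count 0 2 (int l) (?w - int l) = 0" by (intro pair_count_low_weight) auto
    then have "pair_count 1 1 (int l) ?w = 0"
      using pair_count_shift[of 0 1 "int l" "?w - int l"] by (simp add: numeral_2_eq_2)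
    then show ?thesis
      using pair_count_antimono[of 1 "Suc n" 1 "Suc n" "int l" ?w]
        pair_count_nonneg[of "Suc n" "Suc n" "int l" ?w] by simp
  qed
  then show ?thesis by (simp add: shifted_concave_count_def concave_sum_def)
qed

text \<open>The total of the shifts 3 (l + 4 i) + 8, for i < n, that the recursion has made after
  \<open>n\<close> rounds; this is \<open>Q1\<close> in natural numbers.\<close>

definition Q1_nat :: "nat \<Rightarrow> nat \<Rightarrow> nat" where
  "Q1_nat n l = 2 * n * (3 * n + 1) + 3 * n * l"

definition Q2_nat :: "nat \<Rightarrow> nat \<Rightarrow> nat" where
  "Q2_nat n l = Q1_nat n l + 8 * n + 4 + 2 * l"

lemma shifted_concave_count_expand:
  "shifted_concave_count l N =
    (\<Sum>n<K. int_partition_count (N - int (Q1_nat n l)) - int_partition_count (N - int (Q2_nat n l))) +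
    shifted_concave_count (l + 4 * K) (N - int (Q1_nat K l))"
proof (induction K)
  case 0
  then show ?case by (simp add: Q1_nat_def)
next
  case (Suc K)
  have "shifted_concave_count (l + 4 * K) (N - int (Q1_nat K l)) =
    int_partition_count (N - int (Q1_nat K l)) - int_partition_count (N - int (Q2_nat K l)) +
    shifted_concave_count (l + 4 * Suc K) (N - int (Q1_nat (Suc K) l))"
    using shifted_concave_count_rec[of "l + 4 * K" "N - int (Q1_nat K l)"]
    by (simp add: Q1_nat_def Q2_nat_def algebra_simps)
  then show ?case using Suc by simp
qed

text \<open>Any \<open>K > N\<close> makes the argument of the remainder negative. The freedom in
  \<open>K\<close> later permits a limit against the infinite series \<open>IM\<close>.\<close>

lemma shifted_concave_count_eq:
  assumes "K > N"
  shows "shifted_concave_count l (int N) =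
    (\<Sum>n<K. int_partition_count (int N - int (Q1_nat n l)) - int_partition_count (int N - int (Q2_nat n l)))"
proof -
  have "K \<le> Q1_nat K l" by (simp add: Q1_nat_def)
  then have "int N - int (Q1_nat K l) < 0" using assms by simp
  then show ?thesis using shifted_concave_count_expand[of l "int N" K] shifted_concave_count_neg by simp
qed

section \<open>Concave compositions as triples\<close>

lemma is_center_unique: "is_center xs k \<Longrightarrow> is_center xs k' \<Longrightarrow> k = k'"
proof (induction k k' rule: linorder_wlog)
  case (le k k')
  show ?case
  proof (rule ccontr)
    assume "k \<noteq> k'"
    then have "k < k'" using le by simp
    then have "xs ! k > xs ! (k + 1)" "xs ! k < xs ! (k + 1)"
      using le by (auto simp: is_center_def)
    then show False by simp
  qed
qed auto

text \<open>Trades the index conditions for strict monotonicity of two lists, the form in which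
  sorted enumerations of sets provide it.\<close>

lemma is_center_append:
  "is_center (ys @ n # zs) (length ys) \<longleftrightarrow> sorted_wrt (>) (ys @ [n]) \<and> sorted_wrt (<) (n # zs)"
proof -
  let ?xs = "ys @ n # zs"
  have 1: "sorted_wrt (>) (ys @ [n]) \<longleftrightarrow> (\<forall>i. i < length ys \<longrightarrow> ?xs ! i > ?xs ! (i + 1))"
    by (subst sorted_wrt_iff_nth_Suc_transp) (auto simp: nth_append transp_def less_Suc_eq)
  have nth: "?xs ! (length ys + i) = (n # zs) ! i" for i by (simp add: nth_append)
  have 2: "sorted_wrt (<) (n # zs) \<longleftrightarrow>
      (\<forall>i. length ys \<le> i \<and> i + 1 < length ?xs \<longrightarrow> ?xs ! i < ?xs ! (i + 1))"
  proof -
    have "sorted_wrt (<) (n # zs) \<longleftrightarrow> (\<forall>i. Suc i < length (n # zs) \<longrightarrow> (n # zs) ! i < (n # zs) ! Suc i)"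
      by (subst sorted_wrt_iff_nth_Suc_transp) (auto simp: transp_def)
    also have "\<dots> \<longleftrightarrow> (\<forall>i. length ys \<le> i \<and> i + 1 < length ?xs \<longrightarrow> ?xs ! i < ?xs ! (i + 1))"
    proof (intro iffI allI impI)
      fix i assume h: "\<forall>i. Suc i < length (n # zs) \<longrightarrow> (n # zs) ! i < (n # zs) ! Suc i"
        and i: "length ys \<le> i \<and> i + 1 < length ?xs"
      then obtain d where "i = length ys + d" using le_Suc_ex by blast
      then show "?xs ! i < ?xs ! (i + 1)" using h i nth[of d] nth[of "Suc d"] by simp
    next
      fix d assume h: "\<forall>i. length ys \<le> i \<and> i + 1 < length ?xs \<longrightarrow> ?xs ! i < ?xs ! (i + 1)"
        and d: "Suc d < length (n # zs)"
      then show "(n # zs) ! d < (n # zs) ! Suc d"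
        using h[rule_format, of "length ys + d"] nth[of d] nth[of "Suc d"] by simp
    qed
    finally show ?thesis .
  qed
  show ?thesis unfolding is_center_def 1 2 by simp
qed

lemma scc_rank_append:
  assumes "is_center (ys @ n # zs) (length ys)"
  shows "scc_rank (ys @ n # zs) = int (length zs) - int (length ys)"
proof -
  have "(THE k. is_center (ys @ n # zs) k) = length ys"
    using assms is_center_unique by blast
  then show ?thesis by (simp add: scc_rank_def)
qed

text \<open>The triple (n, A, B) is listed as \<open>B\<close> decreasing, then \<open>n\<close>,
  then \<open>A\<close> increasing. The rank is the number of parts to the right of the centre minus
  the number to its left; uniqueness of the centre makes the map injective.\<close>

lemma Vd_eq_concave_sum: "int (Vd j m) = concave_sum 1 j (int m)"
proof -
  let ?S = "SIGMA n:{..m}. pair_set (Suc n) (Suc n) j (int m - int n)"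
  let ?f = "\<lambda>(n, A, B). rev (sorted_list_of_set B) @ n # sorted_list_of_set A"
  have center: "is_center (?f (n, A, B)) (card B)" and rank: "scc_rank (?f (n, A, B)) = int (card A) - int (card B)"
    if "finite A" "finite B" "A \<subseteq> {Suc n..}" "B \<subseteq> {Suc n..}" for n A B
  proof -
    have "sorted_wrt (>) (rev (sorted_list_of_set B) @ [n])" "sorted_wrt (<) (n # sorted_list_of_set A)"
      using that by (auto simp: sorted_wrt_append sorted_wrt_rev Suc_le_eq)
    then show *: "is_center (?f (n, A, B)) (card B)"
      using is_center_append[of "rev (sorted_list_of_set B)"] by simp
    show "scc_rank (?f (n, A, B)) = int (card A) - int (card B)"
      using scc_rank_append[of "rev (sorted_list_of_set B)" n "sorted_list_of_set A"] * by simp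
  qed
  have "bij_betw ?f ?S {xs. strongly_concave xs m \<and> scc_rank xs = j}"
  proof (rule bij_betwI')
    fix x y assume xy: "x \<in> ?S" "y \<in> ?S"
    obtain n A B n' A' B' where e: "x = (n, A, B)" "y = (n', A', B')" by (metis prod_cases3)
    have h: "finite A" "finite B" "A \<subseteq> {Suc n..}" "B \<subseteq> {Suc n..}"
        "finite A'" "finite B'" "A' \<subseteq> {Suc n'..}" "B' \<subseteq> {Suc n'..}"
      using xy e by (auto simp: pair_set_def)
    show "(?f x = ?f y) = (x = y)"
    proof
      assume eq: "?f x = ?f y"
      then have "card B = card B'"
        using center[OF h(1-4)] center[OF h(5-8)] is_center_unique e by metis
      then have "rev (sorted_list_of_set B) = rev (sorted_list_of_set B')"
        "n # sorted_list_of_set A = n' # sorted_list_of_set A'"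
        using eq e by (auto simp: append_eq_append_conv)
      then show "x = y" using h e by (metis list.inject rev_is_rev_conv set_sorted_list_of_set)
    qed simp
  next
    fix x assume x: "x \<in> ?S"
    obtain n A B where e: "x = (n, A, B)" by (metis prod_cases3)
    have h: "n \<le> m" "finite A" "finite B" "A \<subseteq> {Suc n..}" "B \<subseteq> {Suc n..}"
      "int (card A) - int (card B) = j" "int (\<Sum>A) + int (\<Sum>B) = int m - int n"
      using x e by (auto simp: pair_set_def)
    have "sum_list (sorted_list_of_set X) = \<Sum>X" if "finite X" for X :: "nat set"
      using that by (metis distinct_sorted_list_of_set map_ident set_sorted_list_of_set sum_list_distinct_conv_sum_set)
    then have "sum_list (?f x) = m"
      using h e by (simp add: sum_list_rev)
    then show "?f x \<in> {xs. strongly_concave xs m \<and> scc_rank xs = j}"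
      using center[OF h(2-5)] rank[OF h(2-5)] h e by (auto simp: strongly_concave_def)
  next
    fix xs assume "xs \<in> {xs. strongly_concave xs m \<and> scc_rank xs = j}"
    then obtain k where k: "is_center xs k" "sum_list xs = m" "scc_rank xs = j"
      by (auto simp: strongly_concave_def)
    define ys n zs where "ys = take k xs" "n = xs ! k" "zs = drop (Suc k) xs"
    have len: "k < length xs" using k by (simp add: is_center_def)
    have xs: "xs = ys @ n # zs" "length ys = k"
      using len by (simp_all add: ys_n_zs_def id_take_nth_drop)
    have srt: "sorted_wrt (>) (ys @ [n])" "sorted_wrt (<) (n # zs)"
      using k(1) xs is_center_append[of ys n zs] by auto
    have r: "int (length zs) - int (length ys) = j" using scc_rank_append[of ys n zs] k xs by simp
    have s1: "sorted_wrt (<) (rev ys)" "sorted_wrt (<) zs" using srt by (auto simp: sorted_wrt_append sorted_wrt_rev)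
    have l1: "sorted_list_of_set (set ys) = rev ys" "sorted_list_of_set (set zs) = zs"
      using s1 sorted_list_of_set.idem_if_sorted_distinct[of "rev ys"]
        sorted_list_of_set.idem_if_sorted_distinct[of zs] by (auto simp: strict_sorted_iff)
    have d: "distinct ys" "distinct zs" using s1 by (auto simp: strict_sorted_iff)
    have "sum_list ys = \<Sum>(set ys)" "sum_list zs = \<Sum>(set zs)"
      using d sum_list_distinct_conv_sum_set[of _ "\<lambda>x. x"] by auto
    then have "int (\<Sum>(set zs)) + int (\<Sum>(set ys)) = int m - int n"
      using k(2) xs(1) by simp
    moreover have "set zs \<subseteq> {Suc n..}" "set ys \<subseteq> {Suc n..}"
      using srt by (auto simp: sorted_wrt_append Suc_le_eq)
    moreover have "n \<le> m" using k(2) xs(1) by simp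
    ultimately have "(n, set zs, set ys) \<in> ?S"
      using r d by (auto simp: pair_set_def distinct_card)
    moreover have "?f (n, set zs, set ys) = xs" using l1 xs by simp
    ultimately show "\<exists>x\<in>?S. xs = ?f x" by (metis (lifting))
  qed
  then have "Vd j m = card ?S" by (simp add: Vd_def bij_betw_same_card)
  also have "\<dots> = (\<Sum>n\<le>m. card (pair_set (Suc n) (Suc n) j (int m - int n)))"
    using finite_pair_set by (intro card_SigmaI) auto
  finally show ?thesis by (simp add: concave_sum_def pair_count_def of_nat_sum)
qed

lemma Vd_expand:
  assumes "K > N"
  shows "int (Vd (int l) (N + l * (l + 1) div 2)) =
    (\<Sum>n<K. int_partition_count (int N - int (Q1_nat n l)) - int_partition_count (int N - int (Q2_nat n l)))"
  using shifted_concave_count_eq[OF assms, of l]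
  by (simp add: Vd_eq_concave_sum shifted_concave_count_def)

section \<open>Fourier inversion for the partition generating function\<close>

lemma power_Suc_less_one_unit:
  fixes r :: real
  assumes "0 \<le> r" "r < 1" shows "r ^ Suc M < 1"
proof -
  have "r ^ Suc M \<le> r" using assms by (simp add: mult_left_le power_le_one)
  then show ?thesis using assms by simp
qed

lemma bounded_partition_count_Suc_power:
  fixes z :: "'a :: {comm_ring_1}"
  shows "of_nat (bounded_partition_count (Suc M) n) * z ^ n = of_nat (bounded_partition_count M n) * z ^ n +
    (if Suc M \<le> n then of_nat (bounded_partition_count (Suc M) (n - Suc M)) * z ^ (n - Suc M) * z ^ Suc M else 0)"
proof (cases "Suc M \<le> n")
  case True
  then have "z ^ n = z ^ (n - Suc M) * z ^ Suc M" by (simp add: power_add[symmetric] del: power_Suc)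
  then show ?thesis
    using True bounded_partition_count_Suc[of M n] by (simp add: algebra_simps del: power_Suc)
next
  case False
  then show ?thesis using bounded_partition_count_Suc[of M n] by simp
qed

text \<open>By the recursion, a partial sum for \<open>Suc M\<close> is at most one for
  \<open>M\<close> plus \<open>r ^ Suc M\<close> times itself; solving this gives a uniform bound.
  Convergence has to come first, since the product formula solves the same relation for the full
  sums.\<close>

lemma summable_bounded_partition_count:
  fixes r :: real
  assumes "0 \<le> r" "r < 1"
  shows "summable (\<lambda>n. real (bounded_partition_count M n) * r ^ n)"
proof (induction M)
  case 0
  show ?case
    by (rule summable_finite[of "{0}"]) (auto simp: bounded_partition_count_0)
next
  case (Suc M)
  let ?a = "\<lambda>n. real (bounded_partition_count M n) * r ^ n"
  let ?b = "\<lambda>n. real (bounded_partition_count (Suc M) n) * r ^ n"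
  have lt: "r ^ Suc M < 1" by (rule power_Suc_less_one_unit[OF assms])
  show ?case
  proof (rule summableI_nonneg_bounded)
    show "0 \<le> ?b n" for n using assms by simp
    fix K
    have "(\<Sum>n<K. ?b n) = (\<Sum>n<K. ?a n) + (\<Sum>n<K. if Suc M \<le> n then ?b (n - Suc M) * r ^ Suc M else 0)"
      unfolding sum.distrib[symmetric]
    proof (rule sum.cong[OF refl])
      fix n
      show "?b n = ?a n + (if Suc M \<le> n then ?b (n - Suc M) * r ^ Suc M else 0)"
        by (rule bounded_partition_count_Suc_power)
    qed
    also have "(\<Sum>n<K. if Suc M \<le> n then ?b (n - Suc M) * r ^ Suc M else 0) \<le> (\<Sum>n<K. ?b n * r ^ Suc M)"
    proof -
      have "(\<Sum>n<K. if Suc M \<le> n then ?b (n - Suc M) * r ^ Suc M else 0) =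
          (\<Sum>n\<in>{Suc M..<K}. ?b (n - Suc M) * r ^ Suc M)"
        by (rule sum.mono_neutral_cong_right) auto
      also have "\<dots> = (\<Sum>n\<in>(\<lambda>n. n - Suc M) ` {Suc M..<K}. ?b n * r ^ Suc M)"
        by (subst sum.reindex) (auto simp: inj_on_def)
      also have "\<dots> \<le> (\<Sum>n<K. ?b n * r ^ Suc M)"
        using assms by (intro sum_mono2) auto
      finally show ?thesis .
    qed
    finally have "(\<Sum>n<K. ?b n) * (1 - r ^ Suc M) \<le> (\<Sum>n<K. ?a n)"
      unfolding sum_distrib_right[symmetric] right_diff_distrib by linarith
    also have "\<dots> \<le> suminf ?a" using assms Suc by (intro sum_le_suminf) auto
    finally show "(\<Sum>n<K. ?b n) \<le> suminf ?a / (1 - r ^ Suc M)"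
      using lt by (simp add: field_simps)
  qed
qed

text \<open>With a the sum for \<open>M\<close> and b the sum for \<open>Suc M\<close>, the
  recursion reads b = a + b z^(M+1); solving for b appends one factor of Euler's product.\<close>

lemma bounded_partition_count_sums:
  fixes z :: complex
  assumes "norm z < 1"
  shows "(\<lambda>n. of_nat (bounded_partition_count M n) * z ^ n) sums (\<Prod>k=1..M. 1 / (1 - z ^ k))"
proof (induction M)
  case 0
  have "(\<lambda>n. of_nat (bounded_partition_count 0 n) * z ^ n) = (\<lambda>n. if n = 0 then 1 else 0)"
    by (auto simp: bounded_partition_count_0)
  then show ?case using sums_single[of 0 "\<lambda>_. 1 :: complex"] by (simp add: eq_commute)
next
  case (Suc M)
  let ?a = "\<lambda>n. of_nat (bounded_partition_count M n) * z ^ n"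
  let ?b = "\<lambda>n. of_nat (bounded_partition_count (Suc M) n) * z ^ n"
  have "summable (\<lambda>n. norm (?b n))"
    using summable_bounded_partition_count[of "norm z" "Suc M"] assms
    by (simp add: norm_mult norm_power)
  then have b: "?b sums suminf ?b" by (rule summable_sums[OF summable_norm_cancel])
  let ?c = "\<lambda>n. if Suc M \<le> n then ?b (n - Suc M) * z ^ Suc M else 0"
  have "(\<lambda>i. ?c (i + Suc M)) sums (suminf ?b * z ^ Suc M)"
    using sums_mult2[OF b, of "z ^ Suc M"] by simp
  then have "?c sums (suminf ?b * z ^ Suc M + (\<Sum>i<Suc M. ?c i))"
    by (subst (asm) sums_iff_shift)
  then have c: "?c sums (suminf ?b * z ^ Suc M)" by simp
  have "?b n = ?a n + ?c n" for n
    by (rule bounded_partition_count_Suc_power)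
  then have "?b sums ((\<Prod>k=1..M. 1 / (1 - z ^ k)) + suminf ?b * z ^ Suc M)"
    using sums_add[OF Suc c] by simp
  then have "suminf ?b = (\<Prod>k=1..M. 1 / (1 - z ^ k)) + suminf ?b * z ^ Suc M"
    by (rule sums_unique2[OF b])
  moreover have "z ^ Suc M \<noteq> 1"
    using power_Suc_less_one_unit[OF norm_ge_zero assms, of M] by (metis less_irrefl norm_one norm_power)
  ultimately have "suminf ?b = (\<Prod>k=1..M. 1 / (1 - z ^ k)) / (1 - z ^ Suc M)"
    by (simp add: field_simps)
  also have "\<dots> = (\<Prod>k=1..Suc M. 1 / (1 - z ^ k))" by simp
  finally show ?case using b by simp
qed

text \<open>The characteristic function of \<open>\<Sum>k\<le>M. k X\<^sub>k\<close> for independent geometric \<open>X\<^sub>k\<close> with ratio \<open>exp (- s k)\<close>.\<close>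
definition geom_char :: "real \<Rightarrow> nat \<Rightarrow> complex \<Rightarrow> complex" where
  "geom_char s M w = (\<Prod>k=1..M. (1 - of_real (exp (- s * real k))) /
     (1 - of_real (exp (- s * real k)) * exp (\<i> * of_nat k * w)))"

text \<open>The point mass at \<open>m\<close> of the variable with characteristic function
  \<open>geom_char s M\<close>. For \<open>m \<le> M\<close> the bound on the parts is no
  restriction, so this is p(m) exp (- s m) times a factor independent of \<open>m\<close>.\<close>

definition geom_weight :: "real \<Rightarrow> nat \<Rightarrow> int \<Rightarrow> real" where
  "geom_weight s M m = (if m < 0 then 0 else real (bounded_partition_count M (nat m)) * exp (- s * of_int m)) *
     (\<Prod>k=1..M. 1 - exp (- s * real k))"

lemma has_integral_exp_int:
  "((\<lambda>t. exp (\<i> * of_int j * of_real t)) has_integral (if j = 0 then 2 * of_real pi else 0)) {-pi..pi}"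
proof (cases "j = 0")
  case True
  then show ?thesis using has_integral_const_real[of "1 :: complex" "-pi" pi]
    by (simp add: scaleR_conv_of_real mult.commute)
next
  case False
  let ?F = "\<lambda>t::real. exp (\<i> * of_int j * of_real t) / (\<i> * of_int j)"
  have "((\<lambda>t. exp (\<i> * of_int j * of_real t)) has_integral (?F pi - ?F (-pi))) {-pi..pi}"
  proof (rule fundamental_theorem_of_calculus)
    fix t :: real
    have "((\<lambda>t. exp (\<i> * of_int j * t) / (\<i> * of_int j)) has_field_derivative exp (\<i> * of_int j * of_real t)) (at (of_real t))"
      using False by (auto intro!: derivative_eq_intros)
    then show "(?F has_vector_derivative exp (\<i> * of_int j * of_real t)) (at t within {-pi..pi})"
      using has_vector_derivative_real_field has_vector_derivative_at_within by blast
  qed simp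
  moreover have "?F pi = ?F (-pi)"
  proof -
    have "exp (\<i> * of_int j * of_real pi) = exp (\<i> * of_int j * of_real (-pi))"
      by (subst exp_eq) (auto intro!: exI[of _ j] simp: algebra_simps)
    then show ?thesis by simp
  qed
  ultimately show ?thesis using False by simp
qed

text \<open>Divided by its normalising product, \<open>geom_char\<close> is a power series in exp (i
  t) with absolutely summable coefficients. It converges uniformly and can be integrated term by
  term; orthogonality leaves the coefficient at \<open>m\<close>.\<close>

lemma geom_char_fourier:
  assumes "s > 0"
  shows "((\<lambda>t. geom_char s M (of_real t) * exp (- \<i> * of_int m * of_real t)) has_integral
     of_real (2 * pi * geom_weight s M m)) {-pi..pi}"
proof -
  let ?b = "bounded_partition_count M"
  define G where "G = (\<Prod>k=1..M. 1 - exp (- s * real k))"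
  define r where "r = exp (- s)"
  have r: "0 \<le> r" "r < 1" using assms by (auto simp: r_def)
  define f where "f = (\<lambda>n t. of_real (real (?b n) * r ^ n) * exp (\<i> * of_int (int n - m) * of_real t))"
  have powr: "r ^ n = exp (- s * real n)" for n by (simp add: r_def exp_of_nat_mult[symmetric] mult.commute)
  have series: "(\<lambda>n. f n t) sums (geom_char s M (of_real t) * exp (- \<i> * of_int m * of_real t) / of_real G)" for t :: real
  proof -
    define z where "z = of_real r * exp (\<i> * of_real t)"
    have "norm z < 1" using r by (simp add: z_def norm_mult)
    have zk: "z ^ k = of_real (exp (- s * real k)) * exp (\<i> * of_nat k * of_real t)" for k
    proof -
      have "z ^ k = of_real (r ^ k) * exp (of_nat k * (\<i> * of_real t))"
        by (simp add: z_def power_mult_distrib exp_of_nat_mult)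
      then show ?thesis by (simp only: powr mult_ac)
    qed
    have "G > 0" unfolding G_def using assms by (intro prod_pos) auto
    then have "complex_of_real G \<noteq> 0" by simp
    moreover have "complex_of_real G = (\<Prod>k=1..M. 1 - of_real (exp (- s * real k)))"
      unfolding G_def of_real_prod by simp
    moreover have "geom_char s M (of_real t) =
        (\<Prod>k=1..M. 1 - of_real (exp (- s * real k))) * (\<Prod>k=1..M. 1 / (1 - z ^ k))"
      unfolding geom_char_def prod.distrib[symmetric] zk by (intro prod.cong refl) simp
    ultimately have quot: "geom_char s M (of_real t) / of_real G = (\<Prod>k=1..M. 1 / (1 - z ^ k))"
      by (metis nonzero_mult_div_cancel_left)
    have fn: "f n t = of_nat (?b n) * z ^ n * exp (- \<i> * of_int m * of_real t)" for n
    proof -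
      have "exp (\<i> * of_int (int n - m) * of_real t) = exp (\<i> * of_nat n * of_real t) * exp (- \<i> * of_int m * of_real t)"
        by (subst exp_add[symmetric]) (simp add: algebra_simps)
      then show ?thesis by (simp add: f_def zk powr mult_ac)
    qed
    have "(\<lambda>n. f n t) sums ((\<Prod>k=1..M. 1 / (1 - z ^ k)) * exp (- \<i> * of_int m * of_real t))"
      unfolding fn by (rule sums_mult2[OF bounded_partition_count_sums[OF \<open>norm z < 1\<close>]])
    then show ?thesis unfolding quot[symmetric] by simp
  qed
  have "uniform_limit {-pi..pi} (\<lambda>n t. \<Sum>i<n. f i t) (\<lambda>t. \<Sum>i. f i t) sequentially"
  proof (rule Weierstrass_m_test)
    show "norm (f n t) \<le> real (?b n) * r ^ n" for n t
      using r by (simp add: f_def norm_mult norm_power)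
    show "summable (\<lambda>n. real (?b n) * r ^ n)" by (rule summable_bounded_partition_count[OF r])
  qed
  moreover have "(\<lambda>t. \<Sum>i. f i t) = (\<lambda>t. geom_char s M (of_real t) * exp (- \<i> * of_int m * of_real t) / of_real G)"
    using series sums_unique by metis
  ultimately have ul: "uniform_limit {-pi..pi} (\<lambda>n t. \<Sum>i<n. f i t)
      (\<lambda>t. geom_char s M (of_real t) * exp (- \<i> * of_int m * of_real t) / of_real G) sequentially" by simp
  have cont: "continuous_on {-pi..pi} (\<lambda>t. \<Sum>i<n. f i t)" for n
    unfolding f_def by (intro continuous_intros)
  obtain I J where IJ: "\<And>n. ((\<lambda>t. \<Sum>i<n. f i t) has_integral I n) {-pi..pi}"
    "((\<lambda>t. geom_char s M (of_real t) * exp (- \<i> * of_int m * of_real t) / of_real G) has_integral J) {-pi..pi}"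
    "I \<longlonglongrightarrow> J"
    using uniform_limit_integral[OF ul cont sequentially_bot] by blast
  define v where "v = (if m < 0 then 0 else real (?b (nat m)) * exp (- s * of_int m))"
  \<comment> \<open>Beyond \<open>m\<close> the partial sums contain every term with nonzero
    integral, so \<open>I\<close> is eventually constant.\<close>
  have "I n = of_real (2 * pi * v)" if "n > nat m" for n
  proof -
    have "((\<lambda>t. \<Sum>i<n. f i t) has_integral
       (\<Sum>i<n. of_real (real (?b i) * r ^ i) * (if int i - m = 0 then 2 * of_real pi else 0))) {-pi..pi}"
      unfolding f_def by (intro has_integral_sum has_integral_mult_right has_integral_exp_int) auto
    then have "I n = (\<Sum>i<n. of_real (real (?b i) * r ^ i) * (if int i - m = 0 then 2 * of_real pi else 0))"
      using IJ(1) has_integral_unique by blast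
    also have "\<dots> = (\<Sum>i<n. if int i = m then of_real (2 * pi * v) else 0)"
      by (intro sum.cong refl) (auto simp: v_def powr)
    also have "\<dots> = of_real (2 * pi * v)"
    proof (cases "m < 0")
      case True
      then show ?thesis by (auto simp: v_def)
    next
      case False
      then have "(\<Sum>i<n. if int i = m then of_real (2 * pi * v) else 0) =
          (\<Sum>i<n. if i = nat m then complex_of_real (2 * pi * v) else 0)"
        by (intro sum.cong refl) auto
      also have "\<dots> = of_real (2 * pi * v)" using that by (subst sum.delta) auto
      finally show ?thesis .
    qed
    finally show ?thesis .
  qed
  then have "eventually (\<lambda>n. I n = of_real (2 * pi * v)) sequentially"
    by (intro eventually_mono[OF eventually_gt_at_top[of "nat m"]])
  then have J: "J = of_real (2 * pi * v)"
    using IJ(3) by (metis LIMSEQ_unique tendsto_eventually)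
  have "G \<noteq> 0"
    using assms unfolding G_def by (simp add: prod_zero_iff)
  then have cancel: "w / of_real G * of_real G = w" for w :: complex by simp
  have "geom_weight s M m = v * G"
    unfolding geom_weight_def v_def G_def by (rule refl)
  then have "J * of_real G = of_real (2 * pi * geom_weight s M m)" by (simp add: J)
  then show ?thesis
    using has_integral_mult_left[OF IJ(2), of "of_real G"] unfolding cancel by simp
qed

section \<open>Decay of the characteristic function\<close>

text \<open>With d = (1 - p)^2 and y = 2 p (1 - cos u) the squared modulus is d / (d + y). As d <= 1
  it is at most 1 / (1 + y), and 0 <= y <= 4 gives 1 / (1 + y) <= 1 - y / 5 <= exp (- y /
  5).\<close>

lemma norm_geom_factor_le:
  fixes p u :: real
  assumes "0 \<le> p" "p < 1"
  shows "norm ((1 - complex_of_real p) / (1 - of_real p * exp (\<i> * of_real u))) \<le> exp (- (p * (1 - cos u) / 5))"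
proof -
  define y where "y = 2 * p * (1 - cos u)"
  define d where "d = (1 - p)\<^sup>2"
  have y0: "0 \<le> y" using assms by (simp add: y_def)
  have "p * (1 - cos u) \<le> 1 * 2" using assms cos_ge_minus_one[of u] cos_le_one[of u] by (intro mult_mono; linarith)
  then have y4: "y \<le> 4" by (simp add: y_def)
  have d: "0 < d" "d \<le> 1" using assms by (auto simp: d_def power_le_one)
  have "(norm (1 - of_real p * exp (\<i> * complex_of_real u)))\<^sup>2 = (1 - p * cos u)\<^sup>2 + (p * sin u)\<^sup>2"
    by (simp add: cmod_power2 Re_exp Im_exp)
  also have "\<dots> = d + y * 1"
    using sin_cos_squared_add[of u] unfolding d_def y_def by algebra
  finally have n2: "(norm (1 - of_real p * exp (\<i> * complex_of_real u)))\<^sup>2 = d + y" by simp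
  have "norm (1 - complex_of_real p) = 1 - p"
    using assms by (metis abs_of_nonneg diff_ge_0_iff_ge less_imp_le norm_of_real of_real_1 of_real_diff)
  then have "(norm ((1 - complex_of_real p) / (1 - of_real p * exp (\<i> * of_real u))))\<^sup>2 = d / (d + y)"
    using n2 by (simp add: norm_divide power_divide d_def)
  also have "\<dots> \<le> 1 / (1 + y)"
    using d y0 mult_right_mono[of d 1 y] by (simp add: field_simps)
  also have "\<dots> \<le> 1 - y / 5"
    using mult_nonneg_nonneg[of y "4 - y"] y0 y4 by (simp add: field_simps)
  also have "\<dots> \<le> exp (- (y / 5))" using exp_ge_add_one_self[of "- (y / 5)"] by simp
  also have "\<dots> = (exp (- (p * (1 - cos u) / 5)))\<^sup>2"
    by (simp add: exp_double[symmetric] y_def)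
  finally show ?thesis by (rule power2_le_imp_le) simp
qed

lemma norm_geom_char_le:
  assumes "s > 0"
  shows "norm (geom_char s M (of_real t)) \<le> exp (- ((\<Sum>k=1..M. exp (- s * real k) * (1 - cos (real k * t))) / 5))"
proof -
  have "norm (geom_char s M (of_real t)) \<le> (\<Prod>k=1..M. exp (- (exp (- s * real k) * (1 - cos (real k * t)) / 5)))"
    unfolding geom_char_def prod_norm[symmetric]
  proof (rule prod_mono, intro conjI)
    fix k assume "k \<in> {1..M}"
    then have "exp (- s * real k) < 1" using assms by simp
    then show "norm ((1 - complex_of_real (exp (- s * real k))) /
        (1 - of_real (exp (- s * real k)) * exp (\<i> * of_nat k * of_real t)))
        \<le> exp (- (exp (- s * real k) * (1 - cos (real k * t)) / 5))"
      using norm_geom_factor_le[of "exp (- s * real k)" "real k * t"] by (simp add: mult_ac)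
  qed simp
  also have "\<dots> = exp (- ((\<Sum>k=1..M. exp (- s * real k) * (1 - cos (real k * t))) / 5))"
    by (simp add: exp_sum[symmetric] sum_negf sum_divide_distrib)
  finally show ?thesis .
qed

text \<open>For z = r exp (i t) the complete series is 1 / (1 - r) - Re (1 / (1 - z)), which is the
  fraction on the right. Each of the two geometric tails cut off after \<open>M\<close> is at most
  r^(M+1) / (1 - r).\<close>

lemma geom_cos_sum_ge:
  fixes r t :: real
  assumes "0 < r" "r < 1"
  shows "(\<Sum>k=1..M. r ^ k * (1 - cos (real k * t))) \<ge>
    r * (1 + r) * (1 - cos t) / ((1 - r) * ((1 - r)\<^sup>2 + 2 * r * (1 - cos t))) - 2 * r ^ Suc M / (1 - r)"
proof -
  define z where "z = of_real r * exp (\<i> * complex_of_real t)"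
  have nz: "norm z = r" using assms by (simp add: z_def norm_mult)
  have z1: "z \<noteq> 1" using nz assms by auto
  have Rez: "Re (z ^ k) = r ^ k * cos (real k * t)" for k
  proof -
    have "z ^ k = of_real (r ^ k) * exp (of_nat k * (\<i> * of_real t))"
      by (simp add: z_def power_mult_distrib exp_of_nat_mult)
    then show ?thesis by (simp add: Re_exp)
  qed
  have "(\<Sum>k=1..M. r ^ k * (1 - cos (real k * t))) = (\<Sum>k\<le>M. r ^ k * (1 - cos (real k * t)))"
    by (rule sum.mono_neutral_left) (auto simp: not_less_eq_eq)
  also have "\<dots> = (\<Sum>k\<le>M. r ^ k) - Re (\<Sum>k\<le>M. z ^ k)"
    by (simp add: sum_subtractf algebra_simps Rez)
  also have "\<dots> = (1 - r ^ Suc M) / (1 - r) - Re ((1 - z ^ Suc M) / (1 - z))"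
    using assms z1 by (simp only: sum_gp0 if_False) simp
  also have "\<dots> = 1 / (1 - r) - Re (1 / (1 - z)) - r ^ Suc M / (1 - r) + Re (z ^ Suc M / (1 - z))"
    by (simp only: diff_divide_distrib minus_complex.simps)
  finally have eq: "(\<Sum>k=1..M. r ^ k * (1 - cos (real k * t))) =
     1 / (1 - r) - Re (1 / (1 - z)) - r ^ Suc M / (1 - r) + Re (z ^ Suc M / (1 - z))" .
  have "norm (z ^ Suc M / (1 - z)) \<le> r ^ Suc M / (1 - r)"
  proof -
    have "1 - r \<le> norm (1 - z)" using norm_triangle_ineq2[of 1 z] nz by simp
    then show ?thesis
      unfolding norm_divide norm_power nz using assms by (intro divide_left_mono mult_pos_pos) auto
  qed
  then have "- (r ^ Suc M / (1 - r)) \<le> Re (z ^ Suc M / (1 - z))"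
    using abs_Re_le_cmod[of "z ^ Suc M / (1 - z)"] by linarith
  moreover have "1 / (1 - r) - Re (1 / (1 - z)) =
      r * (1 + r) * (1 - cos t) / ((1 - r) * ((1 - r)\<^sup>2 + 2 * r * (1 - cos t)))"
  proof -
    define c where "c = cos t"
    have re: "Re (1 - z) = 1 - r * c" "Im (1 - z) = - (r * sin t)"
      by (simp_all add: z_def Re_exp Im_exp c_def)
    have den: "(1 - r * c)\<^sup>2 + (r * sin t)\<^sup>2 = (1 - r)\<^sup>2 + 2 * r * (1 - c)"
      using sin_cos_squared_add[of t] unfolding c_def by algebra
    have pos: "(1 - r)\<^sup>2 + 2 * r * (1 - c) > 0"
      using assms by (intro add_pos_nonneg) (auto simp: c_def)
    have "Re (1 / (1 - z)) = (1 - r * c) / ((1 - r)\<^sup>2 + 2 * r * (1 - c))"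
      unfolding Re_divide re by (simp add: den)
    moreover have "1 / (1 - r) - (1 - r * c) / D = r * (1 + r) * (1 - c) / ((1 - r) * D)"
      if "D = (1 - r)\<^sup>2 + 2 * r * (1 - c)" "D > 0" for D
    proof -
      have "D - (1 - r) * (1 - r * c) = r * (1 + r) * (1 - c)" unfolding that(1) by algebra
      then show ?thesis using assms that(2) by (simp add: field_simps)
    qed
    ultimately show ?thesis using pos unfolding c_def by simp
  qed
  ultimately show ?thesis unfolding eq by (simp add: field_simps)
qed

lemma sin_ge_third:
  fixes x :: real assumes "0 \<le> x" "x \<le> 2" shows "x / 3 \<le> sin x"
proof -
  have "\<bar>sin x - x\<bar> \<le> x ^ 3 / 6"
    using Maclaurin_sin_bound[of x 3] assms
    by (simp add: sin_coeff_def eval_nat_numeral)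
  moreover have "x ^ 3 \<le> 4 * x"
    using assms mult_mono[of x 2 x 2] mult_right_mono[of "x * x" 4 x] by (simp add: power3_eq_cube)
  ultimately show ?thesis by linarith
qed

lemma one_minus_cos_ge:
  fixes t :: real assumes "\<bar>t\<bar> \<le> pi" shows "t\<^sup>2 / 18 \<le> 1 - cos t"
proof -
  have "\<bar>t\<bar> / 2 / 3 \<le> sin (\<bar>t\<bar> / 2)" using assms pi_less_4 by (intro sin_ge_third) auto
  then have "(\<bar>t\<bar> / 6)\<^sup>2 \<le> (sin (\<bar>t\<bar> / 2))\<^sup>2" by (intro power_mono) auto
  moreover have "cos \<bar>t\<bar> = 1 - 2 * (sin (\<bar>t\<bar> / 2))\<^sup>2" using cos_double_sin[of "\<bar>t\<bar> / 2"] by simp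
  ultimately show ?thesis by (simp add: power_divide)
qed

text \<open>The decay exponent is at least E / 5 - 1 / 5 with E = t^2 / (36 s (s^2 + t^2)). For |t|
  <= s this is Gaussian on the scale s^(3/2), for larger |t| it is of order 1 / s; the sum of two
  exponentials covers both ranges. The truncation at \<open>M\<close> costs a factor exp (1/5) <=
  2.\<close>

lemma norm_geom_char_decay:
  assumes s: "0 < s" "s \<le> 1/2" and t: "\<bar>t\<bar> \<le> pi"
    and M: "2 * exp (- s) ^ Suc M / (1 - exp (- s)) \<le> 1"
  shows "norm (geom_char s M (of_real t)) \<le> 2 * (exp (- (t\<^sup>2 / (360 * s^3))) + exp (- (1 / (360 * s))))"
proof -
  define r where "r = exp (- s)"
  define y where "y = 1 - cos t"
  have r: "0 < r" "r < 1" using s by (auto simp: r_def)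
  have rs: "1 - r \<le> s" using exp_ge_add_one_self[of "- s"] by (simp add: r_def)
  then have r2: "1 / 2 \<le> r" using s by simp
  have y: "t\<^sup>2 / 18 \<le> y" using one_minus_cos_ge[OF t] by (simp add: y_def)
  have y0: "0 \<le> y" by (simp add: y_def)
  define A where "A = r * (1 + r) * y / ((1 - r) * ((1 - r)\<^sup>2 + 2 * r * y))"
  define E where "E = t\<^sup>2 / (36 * s * (s\<^sup>2 + t\<^sup>2))"
  have AE: "E \<le> A"
  proof -
    \<comment> \<open>The bound t^2 / 18 for \<open>y\<close>, with the generous 18 in place of 2 r,
      makes the second factor of the denominator s^2 + t^2. The quotient increases with
      \<open>y\<close>.\<close>
    have "E = (1/2) * (t\<^sup>2 / 18) / (s * (s\<^sup>2 + 18 * (t\<^sup>2 / 18)))" by (simp add: E_def field_simps)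
    also have "\<dots> \<le> (1/2) * y / (s * (s\<^sup>2 + 18 * y))"
    proof -
      have mono: "x / (s * (s\<^sup>2 + 18 * x)) \<le> y / (s * (s\<^sup>2 + 18 * y))" if "0 \<le> x" "x \<le> y" for x y
      proof -
        have "0 < s * (s\<^sup>2 + 18 * x)" "0 < s * (s\<^sup>2 + 18 * y)" using s that by (auto intro!: mult_pos_pos add_pos_nonneg)
        then show ?thesis using that s by (simp add: field_simps)
      qed
      have "(1/2) * ((t\<^sup>2 / 18) / (s * (s\<^sup>2 + 18 * (t\<^sup>2 / 18)))) \<le> (1/2) * (y / (s * (s\<^sup>2 + 18 * y)))"
        using mono[OF _ y] by (intro mult_left_mono) auto
      then show ?thesis by (simp only: times_divide_eq_right)
    qed
    also have "\<dots> \<le> (r * (1 + r)) * y / ((1 - r) * ((1 - r)\<^sup>2 + 2 * r * y))"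
    proof (rule frac_le)
      have "1 / 2 \<le> r * (1 + r)" using r2 mult_mono[of "1/2" r 1 "1 + r"] by simp
      then show "1 / 2 * y \<le> r * (1 + r) * y" using y0 by (intro mult_right_mono)
      show "0 < (1 - r) * ((1 - r)\<^sup>2 + 2 * r * y)" using r y0 by (intro mult_pos_pos add_pos_nonneg) auto
      have "2 * r * y \<le> 18 * y" using r y0 by (intro mult_right_mono) auto
      moreover have "(1 - r)\<^sup>2 \<le> s\<^sup>2" using r rs by (intro power_mono) auto
      ultimately have "(1 - r)\<^sup>2 + 2 * r * y \<le> s\<^sup>2 + 18 * y" by (rule add_mono[rotated])
      then show "(1 - r) * ((1 - r)\<^sup>2 + 2 * r * y) \<le> s * (s\<^sup>2 + 18 * y)"
        using r s y0 rs by (intro mult_mono) auto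
      show "0 \<le> r * (1 + r) * y" using r y0 by simp
    qed
    finally show ?thesis by (simp add: A_def)
  qed
  have pw: "exp (- s * real k) = r ^ k" for k
    by (simp add: r_def exp_of_nat_mult[symmetric] mult.commute)
  have "norm (geom_char s M (of_real t)) \<le> exp (- ((\<Sum>k=1..M. r ^ k * (1 - cos (real k * t))) / 5))"
    using norm_geom_char_le[OF s(1), of M t] unfolding pw .
  also have "\<dots> \<le> exp (1/5 - E / 5)"
  proof -
    have "A - 2 * r ^ Suc M / (1 - r) \<le> (\<Sum>k=1..M. r ^ k * (1 - cos (real k * t)))"
      using geom_cos_sum_ge[OF r, of t M] by (simp only: A_def y_def)
    moreover have "2 * r ^ Suc M / (1 - r) \<le> 1" using M unfolding r_def .
    ultimately show ?thesis using AE by simp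
  qed
  also have "\<dots> = exp (1/5) * exp (- (E / 5))" by (simp add: exp_add[symmetric])
  also have "\<dots> \<le> 2 * (exp (- (t\<^sup>2 / (360 * s^3))) + exp (- (1 / (360 * s))))"
  proof (rule mult_mono)
    have "exp (1/5 :: real) \<le> 1 + 1/5 + (1/5)\<^sup>2" by (rule exp_bound) auto
    then show "exp (1/5 :: real) \<le> 2" by (simp add: power2_eq_square)
    show "exp (- (E / 5)) \<le> exp (- (t\<^sup>2 / (360 * s^3))) + exp (- (1 / (360 * s)))"
    proof (cases "\<bar>t\<bar> \<le> s")
      case True
      then have ts: "t\<^sup>2 \<le> s\<^sup>2" using s abs_le_square_iff[of t s] by simp
      have "t\<^sup>2 / (360 * s^3) = t\<^sup>2 / (180 * s * (2 * s\<^sup>2))" by (simp add: power2_eq_square power3_eq_cube)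
      also have "\<dots> \<le> t\<^sup>2 / (180 * s * (s\<^sup>2 + t\<^sup>2))"
        using s ts by (intro divide_left_mono mult_left_mono mult_pos_pos add_pos_nonneg) auto
      also have "\<dots> = E / 5" by (simp add: E_def)
      finally have "exp (- (E / 5)) \<le> exp (- (t\<^sup>2 / (360 * s^3)))" by simp
      then show ?thesis by (simp add: add_increasing2)
    next
      case False
      then have ts: "s\<^sup>2 \<le> t\<^sup>2" "t\<^sup>2 > 0" using s abs_le_square_iff[of s t] by auto
      have "1 / (360 * s) = t\<^sup>2 / (180 * s * (2 * t\<^sup>2))" using ts by simp
      also have "\<dots> \<le> t\<^sup>2 / (180 * s * (s\<^sup>2 + t\<^sup>2))"
        using s ts by (intro divide_left_mono mult_left_mono mult_pos_pos add_pos_nonneg) auto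
      also have "\<dots> = E / 5" by (simp add: E_def)
      finally have "exp (- (E / 5)) \<le> exp (- (1 / (360 * s)))" by simp
      then show ?thesis by (simp add: add_increasing)
    qed
  qed auto
  finally show ?thesis .
qed

lemma geom_char_denom_nonzero:
  assumes "s > 0" "k \<ge> 1"
  shows "1 - complex_of_real (exp (- s * real k)) * exp (\<i> * of_nat k * of_real t) \<noteq> 0"
proof
  assume "1 - complex_of_real (exp (- s * real k)) * exp (\<i> * of_nat k * of_real t) = 0"
  then have "norm (complex_of_real (exp (- s * real k)) * exp (\<i> * of_nat k * of_real t)) = 1" by simp
  moreover have "norm (exp (\<i> * of_nat k * complex_of_real t)) = 1"
    using norm_exp_i_times[of "real k * t"] by (simp add: mult_ac)
  ultimately have "exp (- s * real k) = 1" by (simp add: norm_mult)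
  then show False using assms by simp
qed

lemma continuous_on_geom_char:
  assumes "s > 0" shows "continuous_on S (\<lambda>t. geom_char s M (of_real t))"
  unfolding geom_char_def using geom_char_denom_nonzero[OF assms]
  by (intro continuous_intros) auto

lemma has_integral_abs_gauss:
  fixes a b :: real
  assumes "a > 0" "b \<ge> 0"
  shows "((\<lambda>t. \<bar>t\<bar> * exp (- (a * t\<^sup>2))) has_integral (1 - exp (- (a * b\<^sup>2))) / a) {-b..b}"
proof -
  have R: "((\<lambda>t. \<bar>t\<bar> * exp (- (a * t\<^sup>2))) has_integral (1 - exp (- (a * b\<^sup>2))) / (2 * a)) {0..b}"
  proof -
    have "((\<lambda>t. t * exp (- (a * t\<^sup>2))) has_integral
        (- exp (- (a * b\<^sup>2)) / (2 * a)) - (- exp (- (a * 0\<^sup>2)) / (2 * a))) {0..b}"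
      using assms by (intro fundamental_theorem_of_calculus)
       (auto intro!: derivative_eq_intros simp flip: has_real_derivative_iff_has_vector_derivative)
    then have "((\<lambda>t. t * exp (- (a * t\<^sup>2))) has_integral (1 - exp (- (a * b\<^sup>2))) / (2 * a)) {0..b}"
      by (simp add: diff_divide_distrib)
    then show ?thesis by (rule has_integral_eq[rotated]) auto
  qed
  have "((\<lambda>t. \<bar>t\<bar> * exp (- (a * t\<^sup>2))) has_integral (1 - exp (- (a * b\<^sup>2))) / (2 * a)) {-b..-0}"
    using R by (subst has_integral_reflect_real[symmetric]) simp
  then have "((\<lambda>t. \<bar>t\<bar> * exp (- (a * t\<^sup>2))) has_integral
      (1 - exp (- (a * b\<^sup>2))) / (2 * a) + (1 - exp (- (a * b\<^sup>2))) / (2 * a)) {-b..b}"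
    using assms R by (intro has_integral_combine[of "-b" 0 b]) auto
  moreover have "(1 - exp (- (a * b\<^sup>2))) / (2 * a) + (1 - exp (- (a * b\<^sup>2))) / (2 * a) = (1 - exp (- (a * b\<^sup>2))) / a"
    by simp
  ultimately show ?thesis by (simp only:)
qed

text \<open>The 360 comes from the Gaussian part. 27 times 360^3 bounds exp (- 1 / (360 s)) / s^3,
  by exp x >= (x / 3)^3, and 32 bounds 2 pi times 4.\<close>

definition decay_const :: real where
  "decay_const = 2 * (360 + 32 * (27 * 360 ^ 3))"

text \<open>A Gaussian of width s^(3/2) has first absolute moment of order s^3, and exp (- 1 / (360
  s)) is also at most a constant times s^3.\<close>

lemma integral_abs_geom_char_le:
  assumes s: "0 < s" "s \<le> 1/2"
    and M: "2 * exp (- s) ^ Suc M / (1 - exp (- s)) \<le> 1"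
  shows "integral {-pi..pi} (\<lambda>t. \<bar>t\<bar> * norm (geom_char s M (of_real t))) \<le> decay_const * s ^ 3"
proof -
  define a where "a = 1 / (360 * s ^ 3)"
  define e where "e = exp (- (1 / (360 * s)))"
  have a: "a > 0" using s by (simp add: a_def)
  have e: "e \<le> 27 * 360 ^ 3 * s ^ 3"
  proof -
    define x where "x = 1 / (360 * s)"
    have x: "x > 0" using s by (simp add: x_def)
    have "(x / 3) ^ 3 \<le> exp (x / 3) ^ 3"
      using x exp_ge_add_one_self[of "x / 3"] by (intro power_mono) linarith+
    also have "\<dots> = exp x" by (simp add: exp_of_nat_mult[symmetric])
    finally have "e \<le> 27 / x ^ 3"
      unfolding e_def x_def[symmetric] using x by (simp add: exp_minus field_simps)
    then show ?thesis using s by (simp add: x_def power_divide power_mult_distrib)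
  qed
  have i2: "((\<lambda>t. 4 * e) has_integral (2 * pi * (4 * e))) {-pi..pi}"
    using has_integral_const_real[of "4 * e" "-pi" pi] by simp
  have i1: "((\<lambda>t. 2 * (\<bar>t\<bar> * exp (- (a * t\<^sup>2)) + 4 * e)) has_integral
      2 * ((1 - exp (- (a * pi\<^sup>2))) / a + 2 * pi * (4 * e))) {-pi..pi}"
    by (intro has_integral_mult_right has_integral_add has_integral_abs_gauss a i2) simp
  have "integral {-pi..pi} (\<lambda>t. \<bar>t\<bar> * norm (geom_char s M (of_real t))) \<le>
      2 * ((1 - exp (- (a * pi\<^sup>2))) / a + 2 * pi * (4 * e))"
  proof (rule has_integral_le[OF integrable_integral i1])
    show "(\<lambda>t. \<bar>t\<bar> * norm (geom_char s M (of_real t))) integrable_on {-pi..pi}"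
      by (intro integrable_continuous_interval continuous_intros continuous_on_geom_char s)
    fix t assume t: "t \<in> {-pi..pi}"
    then have "\<bar>t\<bar> \<le> pi" "\<bar>t\<bar> \<le> 4" using pi_less_4 by auto
    have "norm (geom_char s M (of_real t)) \<le> 2 * (exp (- (a * t\<^sup>2)) + e)"
      using norm_geom_char_decay[OF s \<open>\<bar>t\<bar> \<le> pi\<close> M] by (simp add: a_def e_def)
    then have "\<bar>t\<bar> * norm (geom_char s M (of_real t)) \<le> \<bar>t\<bar> * (2 * (exp (- (a * t\<^sup>2)) + e))"
      by (intro mult_left_mono) auto
    also have "\<dots> \<le> 2 * (\<bar>t\<bar> * exp (- (a * t\<^sup>2)) + 4 * e)"
      using mult_right_mono[OF \<open>\<bar>t\<bar> \<le> 4\<close>, of e] by (simp add: e_def algebra_simps)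
    finally show "\<bar>t\<bar> * norm (geom_char s M (of_real t)) \<le> 2 * (\<bar>t\<bar> * exp (- (a * t\<^sup>2)) + 4 * e)" .
  qed
  also have "\<dots> \<le> 2 * (360 * s ^ 3 + 32 * (27 * 360 ^ 3 * s ^ 3))"
  proof -
    have "(1 - exp (- (a * pi\<^sup>2))) / a \<le> 1 / a" using a by (intro divide_right_mono) auto
    also have "1 / a = 360 * s ^ 3" by (simp add: a_def)
    finally have 1: "(1 - exp (- (a * pi\<^sup>2))) / a \<le> 360 * s ^ 3" .
    have "2 * pi * (4 * e) \<le> 32 * e" using pi_less_4 by (simp add: e_def)
    also have "\<dots> \<le> 32 * (27 * 360 ^ 3 * s ^ 3)" using e by simp
    finally show ?thesis using 1 by (intro mult_left_mono add_mono) auto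
  qed
  also have "\<dots> = decay_const * s ^ 3" by (simp add: decay_const_def algebra_simps)
  finally show ?thesis .
qed

section \<open>Moments\<close>

lemma div_one_minus_exp_le:
  fixes t :: real assumes "t > 0" shows "t / (1 - exp (- t)) \<le> 1 + t"
proof -
  have "exp (- t) \<le> 1 / (1 + t)"
    using exp_ge_add_one_self[of t] assms by (simp add: exp_minus field_simps)
  then have "t / (1 + t) \<le> 1 - exp (- t)" using assms by (simp add: field_simps)
  then show ?thesis using assms by (simp add: field_simps)
qed

text \<open>From t / (1 - exp (- t)) <= 1 + t <= 2 n exp (t / (2 n)): the n-th power uses up exp (t
  / 2), so half of the decay exp (- t) is left for summation.\<close>

lemma moment_term_le:
  fixes t :: real
  assumes "t > 0" "n > 0"
  shows "t ^ n * exp (- t) / (1 - exp (- t)) ^ n \<le> (2 * real n) ^ n * exp (- (t / 2))"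
proof -
  have "1 + t \<le> 2 * real n * (1 + t / (2 * real n))"
    using assms by (simp add: field_simps)
  also have "\<dots> \<le> 2 * real n * exp (t / (2 * real n))"
    using exp_ge_add_one_self by (intro mult_left_mono) auto
  finally have *: "1 + t \<le> 2 * real n * exp (t / (2 * real n))" .
  have "(t / (1 - exp (- t))) ^ n \<le> (2 * real n * exp (t / (2 * real n))) ^ n"
    using order_trans[OF div_one_minus_exp_le[OF assms(1)] *] assms by (intro power_mono) auto
  also have "\<dots> = (2 * real n) ^ n * exp (t / 2)"
    using assms by (simp add: power_mult_distrib exp_of_nat_mult[symmetric])
  finally have "(t / (1 - exp (- t))) ^ n * exp (- t) \<le> (2 * real n) ^ n * exp (t / 2) * exp (- t)"
    by (intro mult_right_mono) auto
  also have "\<dots> = (2 * real n) ^ n * exp (- (t / 2))"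
    by (simp add: mult.assoc exp_add[symmetric])
  finally show ?thesis by (simp add: power_divide)
qed

lemma sum_exp_le:
  fixes c :: real assumes "c > 0" shows "(\<Sum>k=1..M. exp (- (c * real k))) \<le> 1 / c"
proof -
  define x where "x = exp (- c)"
  have x: "0 < x" "x < 1" using assms by (auto simp: x_def)
  have "(\<Sum>k=1..M. exp (- (c * real k))) = (\<Sum>k=1..M. x ^ k)"
    by (intro sum.cong refl) (simp add: x_def exp_of_nat_mult[symmetric] mult.commute)
  also have "\<dots> = (\<Sum>k<M. x ^ Suc k)"
    by (rule sum.reindex_bij_witness[of _ Suc "\<lambda>k. k - 1"]) auto
  also have "\<dots> = x * (\<Sum>k<M. x ^ k)" by (simp add: sum_distrib_left)
  also have "\<dots> \<le> x * (1 / (1 - x))"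
    using x geometric_sums[of x] by (intro mult_left_mono) (auto simp: sums_iff intro!: sum_le_suminf[THEN order_trans])
  also have "\<dots> \<le> 1 / c"
    using exp_ge_add_one_self[of c] x assms by (simp add: x_def exp_minus field_simps)
  finally show ?thesis .
qed

definition geom_mean :: "real \<Rightarrow> nat \<Rightarrow> real" where
  "geom_mean s M = (\<Sum>k=1..M. real k * exp (- s * real k) / (1 - exp (- s * real k)))"

definition geom_var :: "real \<Rightarrow> nat \<Rightarrow> real" where
  "geom_var s M = (\<Sum>k=1..M. real k ^ 2 * exp (- s * real k) / (1 - exp (- s * real k)) ^ 2)"

text \<open>A majorant rather than the third cumulant: its terms arise from the remainder bound of
  \<open>geom_log_deriv_approx\<close>.\<close>

definition geom_third :: "real \<Rightarrow> nat \<Rightarrow> real" where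
  "geom_third s M = (\<Sum>k=1..M. real k ^ 3 * exp (- s * real k) / (1 - exp (- s * real k)) ^ 3)"

lemma moment_sum_le:
  assumes "s > 0" "n > 0"
  shows "(\<Sum>k=1..M. real k ^ n * exp (- s * real k) / (1 - exp (- s * real k)) ^ n) \<le> 2 * (2 * real n) ^ n / s ^ Suc n"
proof -
  have "(\<Sum>k=1..M. real k ^ n * exp (- s * real k) / (1 - exp (- s * real k)) ^ n) \<le>
      (\<Sum>k=1..M. (2 * real n) ^ n / s ^ n * exp (- (s / 2 * real k)))"
  proof (rule sum_mono)
    fix k assume "k \<in> {1..M}"
    then have "(s * real k) ^ n * exp (- (s * real k)) / (1 - exp (- (s * real k))) ^ n
        \<le> (2 * real n) ^ n * exp (- (s * real k / 2))"
      using assms by (intro moment_term_le) auto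
    then have "(s * real k) ^ n * exp (- (s * real k)) / (1 - exp (- (s * real k))) ^ n / s ^ n
        \<le> (2 * real n) ^ n * exp (- (s * real k / 2)) / s ^ n"
      using assms by (intro divide_right_mono) auto
    then show "real k ^ n * exp (- s * real k) / (1 - exp (- s * real k)) ^ n
        \<le> (2 * real n) ^ n / s ^ n * exp (- (s / 2 * real k))"
      using assms by (simp add: power_mult_distrib)
  qed
  also have "\<dots> = (2 * real n) ^ n / s ^ n * (\<Sum>k=1..M. exp (- (s / 2 * real k)))"
    by (simp add: sum_distrib_left)
  also have "\<dots> \<le> (2 * real n) ^ n / s ^ n * (1 / (s / 2))"
    using assms by (intro mult_left_mono sum_exp_le) auto
  also have "\<dots> = 2 * (2 * real n) ^ n / s ^ Suc n" by (simp add: mult_ac)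
  finally show ?thesis .
qed

lemma geom_var_le: "s > 0 \<Longrightarrow> geom_var s M \<le> 32 / s ^ 3"
  using moment_sum_le[of s 2 M] by (simp add: geom_var_def eval_nat_numeral)

lemma geom_third_le: "s > 0 \<Longrightarrow> geom_third s M \<le> 432 / s ^ 4"
  using moment_sum_le[of s 3 M] by (simp add: geom_third_def eval_nat_numeral)

lemma two_le_exp_diff:
  fixes x :: real assumes "0 \<le> x" shows "2 * x \<le> exp x - exp (- x)"
proof -
  have "exp 0 - exp (- 0) - 2 * 0 \<le> exp x - exp (- x) - 2 * x"
  proof (rule DERIV_nonneg_imp_nondecreasing[OF assms])
    fix y :: real
    have "((\<lambda>x. exp x - exp (- x) - 2 * x) has_real_derivative exp y + exp (- y) - 2) (at y)"
      by (auto intro!: derivative_eq_intros)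
    moreover have "exp y + exp (- y) - 2 = (exp (y / 2) - exp (- y / 2))\<^sup>2"
      by (simp add: power2_diff exp_double[symmetric] exp_add[symmetric] mult.assoc)
    ultimately show "\<exists>z. ((\<lambda>x. exp x - exp (- x) - 2 * x) has_real_derivative z) (at y) \<and> 0 \<le> z"
      by (metis zero_le_power2)
  qed
  then show ?thesis by simp
qed

text \<open>This is tanh (t / 2) <= t / 2, cleared of its denominator.\<close>

lemma exp_diff_one_le:
  fixes t :: real assumes "0 \<le> t" shows "exp t - 1 \<le> t / 2 * (exp t + 1)"
proof -
  have "0 / 2 * (exp 0 + 1) - (exp 0 - 1) \<le> t / 2 * (exp t + 1) - (exp t - 1)"
  proof (rule DERIV_nonneg_imp_nondecreasing[OF assms])
    fix y :: real assume "0 \<le> y"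
    have "((\<lambda>t. t / 2 * (exp t + 1) - (exp t - 1)) has_real_derivative (y * exp y + 1 - exp y) / 2) (at y)"
      by (auto intro!: derivative_eq_intros simp: field_simps)
    moreover have "exp y * (1 - y) \<le> exp y * exp (- y)"
      using exp_ge_add_one_self[of "- y"] by (intro mult_left_mono) auto
    then have "0 \<le> (y * exp y + 1 - exp y) / 2" by (simp add: exp_minus algebra_simps)
    ultimately show "\<exists>z. ((\<lambda>t. t / 2 * (exp t + 1) - (exp t - 1)) has_real_derivative z) (at y) \<and> 0 \<le> z"
      by blast
  qed
  then show ?thesis by simp
qed

text \<open>The quotient is 1 / S with S = 4 sinh^2 (t / 2). The upper bound is sinh x >= x; tanh x
  <= x gives S <= t^2 / 4 (S + 4), which rearranges to the lower bound.\<close>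

lemma exp_div_square_bounds:
  fixes t :: real assumes "t > 0"
  shows "exp (- t) / (1 - exp (- t))\<^sup>2 \<le> 1 / t\<^sup>2" "1 / t\<^sup>2 - 1 / 4 \<le> exp (- t) / (1 - exp (- t))\<^sup>2"
proof -
  define S where "S = (exp (t / 2) - exp (- (t / 2)))\<^sup>2"
  have S_eq: "S = exp t + exp (- t) - 2"
    by (simp add: S_def power2_diff exp_double[symmetric] exp_add[symmetric] mult.assoc)
  have "exp (- t) * S = (1 - exp (- t))\<^sup>2"
    by (simp add: S_eq power2_diff algebra_simps exp_add[symmetric] exp_double[symmetric])
  then have inv: "exp (- t) / (1 - exp (- t))\<^sup>2 = 1 / S"
    by (metis exp_not_eq_zero mult.right_neutral nonzero_mult_divide_mult_cancel_left)
  have "t\<^sup>2 \<le> S" unfolding S_def using two_le_exp_diff[of "t / 2"] assms by (intro power_mono) auto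
  then have pos: "S > 0" using assms by (intro less_le_trans[of 0 "t\<^sup>2" S]) auto
  show "exp (- t) / (1 - exp (- t))\<^sup>2 \<le> 1 / t\<^sup>2"
    unfolding inv using \<open>t\<^sup>2 \<le> S\<close> pos assms by (intro divide_left_mono) auto
  have "(exp t - 1)\<^sup>2 \<le> (t / 2 * (exp t + 1))\<^sup>2"
    using exp_diff_one_le[of t] assms by (intro power_mono) auto
  then have "exp (- t) * (exp t - 1)\<^sup>2 \<le> exp (- t) * (t / 2 * (exp t + 1))\<^sup>2"
    by (intro mult_left_mono) auto
  moreover have "exp (- t) * (exp t - 1)\<^sup>2 = S"
    by (simp add: S_eq power2_diff algebra_simps exp_add[symmetric] exp_double[symmetric])
  moreover have "exp (- t) * (t / 2 * (exp t + 1))\<^sup>2 = t\<^sup>2 / 4 * (S + 4)"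
    unfolding S_eq exp_minus by (simp add: field_simps power2_eq_square)
  ultimately have "S \<le> t\<^sup>2 / 4 * (S + 4)" by simp
  then show "1 / t\<^sup>2 - 1 / 4 \<le> exp (- t) / (1 - exp (- t))\<^sup>2"
    unfolding inv using pos assms by (simp add: field_simps)
qed

lemma linear_geometric_sums:
  fixes y :: real assumes "0 < y" "y < 1"
  shows "(\<lambda>k. real (Suc k) * y ^ Suc k) sums (y / (1 - y)\<^sup>2)"
  using sums_mult[OF geometric_deriv_sums[of y], of y] assms by (simp add: mult_ac)

lemma sum_atLeast1_atMost: "(\<Sum>k=1..M. f k) = (\<Sum>k<M. f (Suc k))" for f :: "nat \<Rightarrow> real"
  by (rule sum.reindex_bij_witness[of _ Suc "\<lambda>k. k - 1"]) auto

text \<open>Expanding q / (1 - q) geometrically and summing over \<open>k\<close> first makes the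
  mean a series over \<open>j\<close> whose terms approximate those of zeta(2) / s^2.\<close>

lemma geom_mean_sums:
  assumes "s > 0"
  shows "(\<lambda>j. \<Sum>k<M. real (Suc k) * exp (- (s * real (Suc j))) ^ Suc k) sums geom_mean s M"
proof -
  have "(\<lambda>j. real (Suc k) * exp (- (s * real (Suc j))) ^ Suc k) sums
      (real (Suc k) * exp (- s * real (Suc k)) / (1 - exp (- s * real (Suc k))))" for k
  proof -
    define q where "q = exp (- s * real (Suc k))"
    have q: "0 < q" "q < 1" using assms by (auto simp: q_def)
    have "(\<lambda>j. real (Suc k) * q * q ^ j) sums (real (Suc k) * q * (1 / (1 - q)))"
      using q by (intro sums_mult geometric_sums) auto
    moreover have "q * q ^ j = exp (- (s * real (Suc j))) ^ Suc k" for j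
    proof -
      have "q * q ^ j = q ^ Suc j" by simp
      then show ?thesis
        unfolding q_def exp_of_nat_mult[symmetric] by (simp add: algebra_simps)
    qed
    ultimately show ?thesis unfolding q_def[symmetric] by (simp add: mult.assoc del: power_Suc of_nat_Suc)
  qed
  then show ?thesis unfolding geom_mean_def sum_atLeast1_atMost by (intro sums_sum)
qed

lemma geom_mean_upper:
  assumes "s > 0" shows "geom_mean s M \<le> pi\<^sup>2 / (6 * s\<^sup>2)"
proof (rule sums_le[OF _ geom_mean_sums[OF assms]])
  show "(\<lambda>j. 1 / s\<^sup>2 * (1 / (real j + 1)\<^sup>2)) sums (pi\<^sup>2 / (6 * s\<^sup>2))"
    using sums_mult[OF inverse_squares_sums, of "1 / s\<^sup>2"] by (simp add: mult.commute add.commute)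
  fix j
  define t where "t = s * real (Suc j)"
  have t: "t > 0" using assms by (simp add: t_def)
  have "(\<Sum>k<M. real (Suc k) * exp (- t) ^ Suc k) \<le> exp (- t) / (1 - exp (- t))\<^sup>2"
    using linear_geometric_sums[of "exp (- t)"] t
    by (auto simp: sums_iff intro!: sum_le_suminf[THEN order_trans])
  also have "\<dots> \<le> 1 / t\<^sup>2" by (rule exp_div_square_bounds(1)[OF t])
  finally show "(\<Sum>k<M. real (Suc k) * exp (- (s * real (Suc j))) ^ Suc k) \<le> 1 / s\<^sup>2 * (1 / (real j + 1)\<^sup>2)"
    by (simp add: t_def power_mult_distrib add.commute)
qed

text \<open>The tail is bounded by telescoping, through 1 / (x + 1)^2 <= 1 / x - 1 / (x +
  1).\<close>

lemma sum_inverse_squares_ge: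
  assumes "J > 0" shows "pi\<^sup>2 / 6 - 1 / real J \<le> (\<Sum>j<J. 1 / (real j + 1)\<^sup>2)"
proof -
  have "(\<Sum>j<J + n. 1 / (real j + 1)\<^sup>2) \<le> (\<Sum>j<J. 1 / (real j + 1)\<^sup>2) + 1 / real J - 1 / real (J + n)" for n
  proof (induction n)
    case (Suc n)
    define x where "x = real (J + n)"
    have x: "x > 0" using assms by (simp add: x_def)
    have "1 / (x + 1)\<^sup>2 \<le> 1 / x - 1 / (x + 1)"
    proof -
      have "1 / x - 1 / (x + 1) = 1 / (x * (x + 1))" using x by (simp add: field_simps)
      moreover have "1 / ((x + 1) * (x + 1)) \<le> 1 / (x * (x + 1))"
        using x by (intro divide_left_mono mult_right_mono) auto
      ultimately show ?thesis by (simp add: power2_eq_square)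
    qed
    then show ?case using Suc by (simp add: x_def algebra_simps)
  qed simp
  from order_trans[OF this]
  have bd: "(\<Sum>j<J + n. 1 / (real j + 1)\<^sup>2) \<le> (\<Sum>j<J. 1 / (real j + 1)\<^sup>2) + 1 / real J" for n
    by simp
  have "pi\<^sup>2 / 6 \<le> (\<Sum>j<J. 1 / (real j + 1)\<^sup>2) + 1 / real J"
  proof (rule LIMSEQ_le_const2)
    show "(\<lambda>n. \<Sum>j<n. 1 / (real j + 1)\<^sup>2) \<longlonglongrightarrow> pi\<^sup>2 / 6"
      using inverse_squares_sums by (simp add: sums_def add.commute)
    show "\<exists>N. \<forall>n\<ge>N. (\<Sum>j<n. 1 / (real j + 1)\<^sup>2) \<le> (\<Sum>j<J. 1 / (real j + 1)\<^sup>2) + 1 / real J"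
    proof (intro exI[of _ J] allI impI)
      fix n assume "J \<le> n"
      then have "n = J + (n - J)" by simp
      then show "(\<Sum>j<n. 1 / (real j + 1)\<^sup>2) \<le> (\<Sum>j<J. 1 / (real j + 1)\<^sup>2) + 1 / real J"
        using bd[of "n - J"] by (simp only:)
    qed
  qed
  then show ?thesis by simp
qed

text \<open>Only the first \<open>J\<close>, about 1 / s, values of \<open>j\<close> are kept. The
  lost tail is at most 1 / s, the defects 1 / 4 add up to J / 4, and 1 is given up for stopping at a
  finite \<open>M\<close>; each of the three losses is at most 1 / s.\<close>

lemma geom_mean_lower:
  assumes s: "0 < s" "s \<le> 1"
  shows "eventually (\<lambda>M. pi\<^sup>2 / (6 * s\<^sup>2) - 3 / s \<le> geom_mean s M) sequentially"
proof -
  define J where "J = nat \<lceil>1 / s\<rceil>"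
  have J1: "1 / s \<le> real J" unfolding J_def by linarith
  have J2: "real J \<le> 1 / s + 1" unfolding J_def using s by (simp add: of_nat_nat)
  have J0: "J > 0" using J1 s by (metis gr0I leD of_nat_0 zero_less_divide_1_iff)
  define L where "L = (\<Sum>j<J. exp (- (s * real (Suc j))) / (1 - exp (- (s * real (Suc j))))\<^sup>2)"
  have "(\<lambda>M. \<Sum>j<J. \<Sum>k<M. real (Suc k) * exp (- (s * real (Suc j))) ^ Suc k) \<longlonglongrightarrow> L"
    unfolding L_def
  proof (rule tendsto_sum)
    fix j
    show "(\<lambda>M. \<Sum>k<M. real (Suc k) * exp (- (s * real (Suc j))) ^ Suc k) \<longlonglongrightarrow>
        exp (- (s * real (Suc j))) / (1 - exp (- (s * real (Suc j))))\<^sup>2"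
      using linear_geometric_sums[of "exp (- (s * real (Suc j)))"] s by (simp add: sums_def)
  qed
  then have "eventually (\<lambda>M. L - 1 < (\<Sum>j<J. \<Sum>k<M. real (Suc k) * exp (- (s * real (Suc j))) ^ Suc k)) sequentially"
    by (rule order_tendstoD) simp
  moreover have "(\<Sum>j<J. \<Sum>k<M. real (Suc k) * exp (- (s * real (Suc j))) ^ Suc k) \<le> geom_mean s M" for M
    using geom_mean_sums[OF s(1), of M]
    by (auto simp: sums_iff intro!: sum_le_suminf[THEN order_trans] sum_nonneg)
  moreover have "pi\<^sup>2 / (6 * s\<^sup>2) - 3 / s \<le> L - 1"
  proof -
    have "(\<Sum>j<J. 1 / s\<^sup>2 * (1 / (real j + 1)\<^sup>2) - 1 / 4) \<le> L"
      unfolding L_def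
    proof (rule sum_mono)
      fix j
      have "1 / (s * real (Suc j))\<^sup>2 - 1 / 4 \<le> exp (- (s * real (Suc j))) / (1 - exp (- (s * real (Suc j))))\<^sup>2"
        using s by (intro exp_div_square_bounds(2)) auto
      then show "1 / s\<^sup>2 * (1 / (real j + 1)\<^sup>2) - 1 / 4 \<le> exp (- (s * real (Suc j))) / (1 - exp (- (s * real (Suc j))))\<^sup>2"
        by (simp add: power_mult_distrib add.commute)
    qed
    moreover have "(\<Sum>j<J. 1 / s\<^sup>2 * (1 / (real j + 1)\<^sup>2) - 1 / 4) =
        1 / s\<^sup>2 * (\<Sum>j<J. 1 / (real j + 1)\<^sup>2) - real J / 4"
      by (simp add: sum_subtractf sum_distrib_left)
    moreover have "1 / s\<^sup>2 * (pi\<^sup>2 / 6 - 1 / real J) \<le> 1 / s\<^sup>2 * (\<Sum>j<J. 1 / (real j + 1)\<^sup>2)"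
      by (intro mult_left_mono sum_inverse_squares_ge J0) auto
    moreover have "1 / s\<^sup>2 * (1 / real J) \<le> 1 / s"
    proof -
      have "1 / s\<^sup>2 * (1 / real J) \<le> 1 / s\<^sup>2 * s"
        using J1 J0 s by (intro mult_left_mono) (auto simp: field_simps)
      then show ?thesis using s by (simp add: power2_eq_square)
    qed
    moreover have "1 \<le> 1 / s" using s by simp
    moreover have "1 / s\<^sup>2 * (pi\<^sup>2 / 6 - 1 / real J) = pi\<^sup>2 / (6 * s\<^sup>2) - 1 / s\<^sup>2 * (1 / real J)"
      by (simp add: right_diff_distrib mult.commute)
    moreover have "3 / s = 1 / s + 1 / s + 1 / s" by simp
    ultimately show ?thesis using J2 by linarith
  qed
  ultimately show ?thesis by (elim eventually_mono) (rule order_trans[OF order_trans[OF _ less_imp_le]])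
qed

section \<open>Gaussian approximation near the saddle point\<close>

lemma norm_exp_i_minus_one_le: "norm (exp (\<i> * of_real u) - 1) \<le> \<bar>u\<bar>"
  using Taylor_exp[of "\<i> * of_real u" 0] by (simp add: norm_mult)

lemma norm_exp_i_second_order_le: "norm (exp (\<i> * of_real u) - 1 - \<i> * of_real u) \<le> u\<^sup>2"
  using Taylor_exp[of "\<i> * of_real u" 1] by (simp add: norm_mult power2_eq_square algebra_simps)

text \<open>First-order expansion in \<open>u\<close> with an exact remainder: after P / (1 - P)^2
  is factored out, the two pieces of the numerator are at most u^2 (1 - p) and u^2 p, which add up
  to u^2, while |1 - P z| >= 1 - p.\<close>

lemma geom_log_deriv_approx:
  fixes p u :: real
  assumes "0 \<le> p" "p < 1"
  shows "norm (of_real p * exp (\<i> * of_real u) / (1 - of_real p * exp (\<i> * of_real u)) - of_real (p / (1 - p))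
     - \<i> * of_real (u * (p / (1 - p)\<^sup>2))) \<le> u\<^sup>2 * (p / (1 - p) ^ 3)"
proof -
  define z where "z = exp (\<i> * complex_of_real u)"
  define P where "P = complex_of_real p"
  define U where "U = \<i> * complex_of_real u"
  have nz: "norm z = 1" by (simp add: z_def)
  have lb: "1 - p \<le> norm (1 - P * z)"
    using norm_triangle_ineq2[of 1 "P * z"] nz assms by (simp add: P_def norm_mult)
  then have ne: "1 - P * z \<noteq> 0" using assms by auto
  have "P \<noteq> 1" using assms by (simp add: P_def)
  then have ne1: "1 - P \<noteq> 0" by simp
  have "P * z / (1 - P * z) - P / (1 - P) - U * (P / (1 - P)\<^sup>2) =
      P / (1 - P)\<^sup>2 * (((z - 1 - U) * (1 - P) + U * P * (z - 1)) / (1 - P * z))"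
    using ne ne1 by (simp add: divide_simps) (simp add: power2_eq_square algebra_simps)
  then have "norm (P * z / (1 - P * z) - P / (1 - P) - U * (P / (1 - P)\<^sup>2)) =
      norm (P / (1 - P)\<^sup>2) * (norm ((z - 1 - U) * (1 - P) + U * P * (z - 1)) / norm (1 - P * z))"
    by (simp only: norm_mult norm_divide)
  also have "norm (P / (1 - P)\<^sup>2) = p / (1 - p)\<^sup>2"
  proof -
    have "P / (1 - P)\<^sup>2 = of_real (p / (1 - p)\<^sup>2)" by (simp add: P_def)
    then show ?thesis using assms by (simp only: norm_of_real) simp
  qed
  also have "norm ((z - 1 - U) * (1 - P) + U * P * (z - 1)) \<le> u\<^sup>2"
  proof -
    have "norm ((z - 1 - U) * (1 - P)) \<le> u\<^sup>2 * (1 - p)"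
    proof -
      have "1 - P = of_real (1 - p)" by (simp add: P_def)
      then have "norm (1 - P) = 1 - p" using assms by (simp only: norm_of_real)
      then show ?thesis unfolding norm_mult z_def U_def
        using norm_exp_i_second_order_le[of u] assms by (simp add: mult_right_mono)
    qed
    moreover have "norm (U * P * (z - 1)) \<le> \<bar>u\<bar> * p * \<bar>u\<bar>"
      unfolding norm_mult z_def U_def P_def
      using norm_exp_i_minus_one_le[of u] assms by (auto simp: norm_mult intro!: mult_left_mono)
    moreover have "u\<^sup>2 * (1 - p) + \<bar>u\<bar> * p * \<bar>u\<bar> = u\<^sup>2"
      by (simp add: power2_eq_square algebra_simps abs_mult_self_eq) 
    ultimately show ?thesis
      using norm_triangle_ineq[of "(z - 1 - U) * (1 - P)" "U * P * (z - 1)"] by linarith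
  qed
  also have "p / (1 - p)\<^sup>2 * (u\<^sup>2 / norm (1 - P * z)) \<le> p / (1 - p)\<^sup>2 * (u\<^sup>2 / (1 - p))"
    using lb assms ne by (intro mult_left_mono divide_left_mono mult_pos_pos) auto
  also have "\<dots> = u\<^sup>2 * (p / (1 - p) ^ 3)" by (simp add: power2_eq_square power3_eq_cube)
  finally show ?thesis
    using assms by (simp add: z_def U_def P_def divide_right_mono mult_left_mono mult.assoc)
qed

definition geom_log_deriv :: "real \<Rightarrow> nat \<Rightarrow> real \<Rightarrow> complex" where
  "geom_log_deriv s M t = (\<Sum>k=1..M. \<i> * of_nat k * (of_real (exp (- s * real k)) * exp (\<i> * of_real (real k * t)) /
     (1 - of_real (exp (- s * real k)) * exp (\<i> * of_real (real k * t)))))"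

lemma geom_char_deriv:
  assumes "s > 0"
  shows "(geom_char s M has_field_derivative geom_char s M (of_real t) * geom_log_deriv s M t) (at (of_real t))"
proof -
  let ?f = "\<lambda>k w. (1 - complex_of_real (exp (- s * real k))) / (1 - of_real (exp (- s * real k)) * exp (\<i> * of_nat k * w))"
  let ?w = "complex_of_real t"
  let ?d = "\<lambda>k. ?f k ?w * (\<i> * of_nat k * (of_real (exp (- s * real k)) * exp (\<i> * of_nat k * ?w) /
     (1 - of_real (exp (- s * real k)) * exp (\<i> * of_nat k * ?w))))"
  have q: "exp (- s * real k) \<noteq> 1" if "k \<in> {1..M}" for k using assms that by simp
  have ne: "?f k ?w \<noteq> 0" if "k \<in> {1..M}" for k
    using geom_char_denom_nonzero[OF assms, of k t] q[OF that] that
    by (metis atLeastAtMost_iff divide_eq_0_iff eq_iff_diff_eq_0 of_real_eq_1_iff)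
  have d: "(?f k has_field_derivative ?d k) (at ?w)" if "k \<in> {1..M}" for k
  proof -
    define Q where "Q = complex_of_real (exp (- s * real k))"
    have "1 - Q * exp (\<i> * of_nat k * ?w) \<noteq> 0"
      using geom_char_denom_nonzero[OF assms, of k t] that by (simp add: Q_def)
    then have "((\<lambda>w. (1 - Q) / (1 - Q * exp (\<i> * of_nat k * w))) has_field_derivative
       (1 - Q) / (1 - Q * exp (\<i> * of_nat k * ?w)) * (\<i> * of_nat k * (Q * exp (\<i> * of_nat k * ?w) / (1 - Q * exp (\<i> * of_nat k * ?w))))) (at ?w)"
      by (auto intro!: derivative_eq_intros simp: divide_simps)
    then show ?thesis unfolding Q_def .
  qed
  have "((\<lambda>w. \<Prod>k\<in>{1..M}. ?f k w) has_field_derivative (\<Prod>k\<in>{1..M}. ?f k ?w) * (\<Sum>k\<in>{1..M}. ?d k / ?f k ?w)) (at ?w)"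
    using has_field_derivative_prod'[of "{1..M}" ?f ?w ?d] ne d by blast
  moreover have "(\<Sum>k\<in>{1..M}. ?d k / ?f k ?w) = geom_log_deriv s M t"
    unfolding geom_log_deriv_def
  proof (rule sum.cong[OF refl])
    fix k assume "k \<in> {1..M}"
    from ne[OF this] show "?d k / ?f k ?w = \<i> * of_nat k * (of_real (exp (- s * real k)) * exp (\<i> * of_real (real k * t)) /
     (1 - of_real (exp (- s * real k)) * exp (\<i> * of_real (real k * t))))"
      by (subst nonzero_mult_div_cancel_left) (simp_all add: mult.assoc)
  qed
  ultimately show ?thesis unfolding geom_char_def[abs_def] by simp
qed

text \<open>The estimate for one factor at u = k t, multiplied by i k and summed, collects into
  mean, variance and \<open>geom_third\<close>.\<close>

lemma geom_log_deriv_approx_sum: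
  assumes "s > 0"
  shows "norm (geom_log_deriv s M t - \<i> * of_real (geom_mean s M) + of_real (t * geom_var s M)) \<le> t\<^sup>2 * geom_third s M"
proof -
  define q where "q = (\<lambda>k::nat. exp (- s * real k))"
  have qf: "exp (- s * real k) = q k" for k by (simp add: q_def)
  let ?h = "\<lambda>k. of_real (q k) * exp (\<i> * of_real (real k * t)) / (1 - of_real (q k) * exp (\<i> * of_real (real k * t)))"
  let ?e = "\<lambda>k. ?h k - of_real (q k / (1 - q k)) - \<i> * of_real (real k * t * (q k / (1 - q k)\<^sup>2))"
  have eq: "geom_log_deriv s M t - \<i> * of_real (geom_mean s M) + of_real (t * geom_var s M) = (\<Sum>k=1..M. \<i> * of_nat k * ?e k)"
  proof -
    have "\<i> * of_nat k * ?e k = \<i> * of_nat k * ?h k - \<i> * of_real (real k * q k / (1 - q k)) +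
        of_real t * of_real (real k ^ 2 * q k / (1 - q k)\<^sup>2)" for k
      by (simp add: algebra_simps power2_eq_square)
    then have "(\<Sum>k=1..M. \<i> * of_nat k * ?e k) = (\<Sum>k=1..M. \<i> * of_nat k * ?h k) -
       \<i> * (\<Sum>k=1..M. of_real (real k * q k / (1 - q k))) + of_real t * (\<Sum>k=1..M. of_real (real k ^ 2 * q k / (1 - q k)\<^sup>2))"
      by (simp only: sum.distrib sum_subtractf sum_distrib_left)
    then show ?thesis
      unfolding geom_log_deriv_def geom_mean_def geom_var_def qf of_real_sum[symmetric] of_real_mult by (rule sym)
  qed
  have "norm (\<Sum>k=1..M. \<i> * of_nat k * ?e k) \<le> (\<Sum>k=1..M. t\<^sup>2 * (real k ^ 3 * q k / (1 - q k) ^ 3))"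
  proof (rule sum_norm_le)
    fix k assume "k \<in> {1..M}"
    then have "0 \<le> q k" "q k < 1" using assms by (auto simp: q_def)
    then have "norm (?e k) \<le> (real k * t)\<^sup>2 * (q k / (1 - q k) ^ 3)" by (rule geom_log_deriv_approx)
    then have "real k * norm (?e k) \<le> real k * ((real k * t)\<^sup>2 * (q k / (1 - q k) ^ 3))"
      by (intro mult_left_mono) auto
    then show "norm (\<i> * of_nat k * ?e k) \<le> t\<^sup>2 * (real k ^ 3 * q k / (1 - q k) ^ 3)"
      by (simp add: norm_mult power_mult_distrib power2_eq_square power3_eq_cube mult_ac)
  qed
  also have "\<dots> = t\<^sup>2 * geom_third s M" unfolding geom_third_def qf sum_distrib_left by (rule refl)
  finally show ?thesis unfolding eq .
qed

lemma norm_geom_char_le_1: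
  assumes "s > 0" shows "norm (geom_char s M (of_real t)) \<le> 1"
proof -
  have "0 \<le> (\<Sum>k=1..M. exp (- s * real k) * (1 - cos (real k * t)))" by (intro sum_nonneg) auto
  then have "exp (- ((\<Sum>k=1..M. exp (- s * real k) * (1 - cos (real k * t))) / 5)) \<le> 1" by simp
  then show ?thesis using norm_geom_char_le[OF assms, of M t] by (rule order_trans[rotated])
qed

text \<open>Multiplying by \<open>exp (geom_var * t\<^sup>2 / 2)\<close> removes the linear term of the logarithmic derivative.\<close>
lemma geom_char_gauss_approx:
  assumes s: "s > 0" and T: "\<bar>t\<bar> \<le> T"
  shows "norm (geom_char s M (of_real t) * exp (- \<i> * of_real \<nu> * of_real t) * exp (of_real (geom_var s M * t\<^sup>2 / 2)) - 1)
    \<le> exp (geom_var s M * T\<^sup>2 / 2) * (\<bar>geom_mean s M - \<nu>\<bar> + T\<^sup>2 * geom_third s M) * T"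
proof -
  define v where "v = geom_var s M"
  define G where "G = (\<lambda>w. geom_char s M w * exp (- \<i> * of_real \<nu> * w) * exp (of_real v * w\<^sup>2 / 2))"
  \<comment> \<open>\<open>geom_log_deriv\<close> takes a real argument, hence \<open>Re w\<close>;
    \<open>G'\<close> serves as derivative on the real segment.\<close>
  define G' where "G' = (\<lambda>w. let x = Re w in G w * (geom_log_deriv s M x - \<i> * of_real \<nu> + of_real (v * x)))"
  have T0: "0 \<le> T" using T by simp
  have v0: "0 \<le> v" unfolding v_def geom_var_def by (intro sum_nonneg) auto
  have k0: "0 \<le> geom_third s M" unfolding geom_third_def using s by (intro sum_nonneg) auto
  let ?S = "closed_segment (complex_of_real (- T)) (of_real T)"
  have S: "?S = of_real ` {-T..T}"
    using T0 by (subst closed_segment_of_real) (simp add: closed_segment_eq_real_ivl)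
  \<comment> \<open>Mean value inequality along the segment from - T to T inside the complex
    plane.\<close>
  have "norm (G (of_real t) - G 0) \<le>
      exp (v * T\<^sup>2 / 2) * (\<bar>geom_mean s M - \<nu>\<bar> + T\<^sup>2 * geom_third s M) * norm (complex_of_real t - 0)"
  proof (rule field_differentiable_bound[of ?S _ G'])
    show "convex ?S" by simp
    show "complex_of_real t \<in> ?S" using T unfolding S by (intro imageI) auto
    show "0 \<in> ?S" unfolding S using T0 by (auto intro!: image_eqI[of _ _ 0])
    fix w assume "w \<in> ?S"
    then obtain x where x: "w = of_real x" "\<bar>x\<bar> \<le> T" unfolding S by auto
    have "(G has_field_derivative G' w) (at w)"
      unfolding G_def G'_def x(1)
      by (rule derivative_eq_intros geom_char_deriv[OF s] refl | simp)+ (simp add: algebra_simps)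
    then show "(G has_field_derivative G' w) (at w within ?S)" by (rule has_field_derivative_at_within)
    have x2: "x\<^sup>2 \<le> T\<^sup>2" using x(2) T0 abs_le_square_iff[of x T] by simp
    have "norm (G w) \<le> 1 * 1 * exp (v * T\<^sup>2 / 2)"
      unfolding G_def norm_mult
    proof (intro mult_mono)
      show "norm (geom_char s M w) \<le> 1" unfolding x(1) by (rule norm_geom_char_le_1[OF s])
      show "norm (exp (- \<i> * of_real \<nu> * w)) \<le> 1" by (simp add: x(1))
      have "of_real v * w\<^sup>2 / 2 = of_real (v * x\<^sup>2 / 2)" by (simp add: x(1))
      then have "norm (exp (of_real v * w\<^sup>2 / 2)) = exp (v * x\<^sup>2 / 2)"
        by (simp only: exp_of_real norm_of_real) simp
      also have "\<dots> \<le> exp (v * T\<^sup>2 / 2)" using x2 v0 by (simp add: mult_left_mono)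
      finally show "norm (exp (of_real v * w\<^sup>2 / 2)) \<le> exp (v * T\<^sup>2 / 2)" .
    qed auto
    moreover have "norm (geom_log_deriv s M x - \<i> * of_real \<nu> + of_real (v * x)) \<le>
        \<bar>geom_mean s M - \<nu>\<bar> + T\<^sup>2 * geom_third s M"
    proof -
      have eq: "geom_log_deriv s M x - \<i> * of_real \<nu> + of_real (v * x) =
          (geom_log_deriv s M x - \<i> * of_real (geom_mean s M) + of_real (x * geom_var s M)) +
          \<i> * of_real (geom_mean s M - \<nu>)" by (simp add: v_def algebra_simps)
      have "norm (geom_log_deriv s M x - \<i> * of_real \<nu> + of_real (v * x)) \<le> x\<^sup>2 * geom_third s M + \<bar>geom_mean s M - \<nu>\<bar>"
        unfolding eq by (intro norm_triangle_le add_mono geom_log_deriv_approx_sum s) (simp add: norm_mult flip: of_real_diff)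
      also have "x\<^sup>2 * geom_third s M \<le> T\<^sup>2 * geom_third s M" using x2 k0 by (rule mult_right_mono)
      finally show ?thesis by simp
    qed
    ultimately show "norm (G' w) \<le> exp (v * T\<^sup>2 / 2) * (\<bar>geom_mean s M - \<nu>\<bar> + T\<^sup>2 * geom_third s M)"
      unfolding G'_def Let_def norm_mult using x by (intro mult_mono) auto
  qed
  also have "\<dots> \<le> exp (v * T\<^sup>2 / 2) * (\<bar>geom_mean s M - \<nu>\<bar> + T\<^sup>2 * geom_third s M) * T"
    using T k0 by (intro mult_left_mono) auto
  finally have "norm (G (of_real t) - G 0) \<le> exp (v * T\<^sup>2 / 2) * (\<bar>geom_mean s M - \<nu>\<bar> + T\<^sup>2 * geom_third s M) * T" .
  moreover have "G 0 = 1"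
  proof -
    have "geom_char s M 0 = 1"
      unfolding geom_char_def using s by (intro prod.neutral) auto
    then show ?thesis by (simp add: G_def)
  qed
  ultimately show ?thesis by (simp add: G_def v_def)
qed

section \<open>Lipschitz bound for the point masses\<close>

text \<open>Under the Fourier integral, |exp (- i m t) - exp (- i m' t)| <= |m - m'| |t|, so the
  first absolute moment of \<open>geom_char\<close> controls the difference.\<close>

lemma geom_weight_lipschitz:
  assumes s: "0 < s" "s \<le> 1/2"
    and M: "2 * exp (- s) ^ Suc M / (1 - exp (- s)) \<le> 1"
  shows "2 * pi * \<bar>geom_weight s M m - geom_weight s M m'\<bar> \<le> decay_const * s ^ 3 * \<bar>of_int (m - m')\<bar>"
proof -
  let ?f = "\<lambda>m t. geom_char s M (of_real t) * exp (- \<i> * of_int m * of_real t)"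
  let ?g = "\<lambda>t. \<bar>of_int (m - m')\<bar> * (\<bar>t\<bar> * norm (geom_char s M (of_real t)))"
  have int: "((\<lambda>t. ?f m t - ?f m' t) has_integral
      (of_real (2 * pi * geom_weight s M m) - of_real (2 * pi * geom_weight s M m'))) {-pi..pi}"
    by (intro has_integral_diff geom_char_fourier s)
  have "norm (integral {-pi..pi} (\<lambda>t. ?f m t - ?f m' t)) \<le> integral {-pi..pi} ?g"
  proof (rule integral_norm_bound_integral)
    show "(\<lambda>t. ?f m t - ?f m' t) integrable_on {-pi..pi}" using int by blast
    show "?g integrable_on {-pi..pi}"
      by (intro integrable_continuous_interval continuous_intros continuous_on_geom_char s)
    fix t :: real
    have "exp (- \<i> * of_int m * of_real t) = exp (- \<i> * of_int m' * of_real t) * exp (\<i> * of_real (of_int (m' - m) * t))"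
      by (subst exp_add[symmetric]) (simp add: algebra_simps)
    then have "exp (- \<i> * of_int m * of_real t) - exp (- \<i> * of_int m' * of_real t) =
        exp (- \<i> * of_int m' * of_real t) * (exp (\<i> * of_real (of_int (m' - m) * t)) - 1)"
      by (simp only: right_diff_distrib mult_1_right)
    moreover have "norm (exp (- \<i> * of_int m' * complex_of_real t)) = 1" by simp
    ultimately have "norm (exp (- \<i> * of_int m * complex_of_real t) - exp (- \<i> * of_int m' * of_real t)) \<le> \<bar>of_int (m' - m) * t\<bar>"
      using norm_exp_i_minus_one_le[of "of_int (m' - m) * t"] by (simp only: norm_mult mult_1_left)
    then have "norm (geom_char s M (of_real t)) * norm (exp (- \<i> * of_int m * complex_of_real t) - exp (- \<i> * of_int m' * of_real t))
        \<le> norm (geom_char s M (of_real t)) * \<bar>of_int (m' - m) * t\<bar>"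
      by (rule mult_left_mono) simp
    then show "norm (?f m t - ?f m' t) \<le> ?g t"
      unfolding right_diff_distrib[symmetric] norm_mult
      by (simp add: abs_mult abs_minus_commute mult_ac)
  qed
  also have "\<dots> = \<bar>of_int (m - m')\<bar> * integral {-pi..pi} (\<lambda>t. \<bar>t\<bar> * norm (geom_char s M (of_real t)))"
    by simp
  also have "\<dots> \<le> \<bar>of_int (m - m')\<bar> * (decay_const * s ^ 3)"
    by (intro mult_left_mono integral_abs_geom_char_le assms) auto
  finally have "norm (complex_of_real (2 * pi * geom_weight s M m) - of_real (2 * pi * geom_weight s M m')) \<le>
      decay_const * s ^ 3 * \<bar>of_int (m - m')\<bar>"
    using integral_unique[OF int] by (simp add: mult.commute)
  moreover have "norm (complex_of_real (2 * pi * geom_weight s M m) - of_real (2 * pi * geom_weight s M m')) =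
      2 * pi * \<bar>geom_weight s M m - geom_weight s M m'\<bar>"
    by (simp only: norm_of_real of_real_diff[symmetric] right_diff_distrib[symmetric] abs_mult) simp
  ultimately show ?thesis by simp
qed

section \<open>The error term\<close>

text \<open>Chosen so that \<open>decay_const / window\<close> is exp (- 16) / 2: the far range of
  the Fourier integral then costs at most half of what the central range yields.\<close>

definition window :: real where "window = 2 * decay_const * exp 16"

text \<open>Three ranges of t, with \<tau> = s^(3/2) and K = \<open>window\<close>. For |t| <=
  \<tau> the Gaussian keeps the real part above exp (- 16) / 2, since the variance times \<tau>^2 is
  at most 32. Up to K \<tau> the real part stays nonnegative. Beyond, the modulus is at most |t| /
  (K \<tau>) times itself, and the moment bound applies.\<close>

lemma geom_weight_lower:
  assumes s: "0 < s" "s \<le> 1/2"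
    and M: "2 * exp (- s) ^ Suc M / (1 - exp (- s)) \<le> 1"
    and mean: "\<bar>geom_mean s M - real_of_int m\<bar> \<le> 3 / s"
    and small: "window * exp (16 * window\<^sup>2) * (3 + 432 * window\<^sup>2) * sqrt s \<le> 1/2"
  shows "exp (- 16) / 2 * (s * sqrt s) \<le> 2 * pi * geom_weight s M m"
proof -
  define K where "K = window"
  define \<tau> where "\<tau> = s * sqrt s"
  have K: "K > 0" by (simp add: K_def window_def decay_const_def)
  have \<tau>: "\<tau> > 0" using s by (simp add: \<tau>_def)
  have \<tau>2: "\<tau>\<^sup>2 = s ^ 3" using s by (simp add: \<tau>_def power_mult_distrib power2_eq_square power3_eq_cube)
  have "\<tau> \<le> 1 * 1" unfolding \<tau>_def using s by (intro mult_mono) auto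
  then have \<tau>pi: "\<tau> \<le> pi" using pi_gt3 by linarith
  define v where "v = geom_var s M"
  have v: "v \<le> 32 / s ^ 3" unfolding v_def by (rule geom_var_le[OF s(1)])
  have v0: "0 \<le> v" unfolding v_def geom_var_def by (intro sum_nonneg) auto
  let ?f = "\<lambda>t. geom_char s M (of_real t) * exp (- \<i> * of_int m * of_real t)"
  let ?n = "\<lambda>t. \<bar>t\<bar> * norm (geom_char s M (of_real t))"
  \<comment> \<open>After multiplication by exp (v t^2 / 2) the integrand is within 1 / 2 of 1, so
    its real part is at least 1 / 2.\<close>
  have near: "1/2 * exp (- (v * t\<^sup>2 / 2)) \<le> Re (?f t)" if t: "\<bar>t\<bar> \<le> K * \<tau>" for t
  proof -
    have "norm (?f t * exp (of_real (v * t\<^sup>2 / 2)) - 1) \<le>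
        exp (v * (K * \<tau>)\<^sup>2 / 2) * (\<bar>geom_mean s M - of_int m\<bar> + (K * \<tau>)\<^sup>2 * geom_third s M) * (K * \<tau>)"
      using geom_char_gauss_approx[OF s(1) t, of M "of_int m"] by (simp add: v_def)
    also have "\<dots> \<le> exp (16 * K\<^sup>2) * (3 / s + 432 * K\<^sup>2 / s) * (K * \<tau>)"
    proof (intro mult_right_mono mult_mono add_mono mean)
      have "v * (K * \<tau>)\<^sup>2 \<le> 32 / s ^ 3 * (K * \<tau>)\<^sup>2" using v by (intro mult_right_mono) auto
      also have "\<dots> = 32 * K\<^sup>2" using s by (simp add: power_mult_distrib \<tau>2)
      finally show "exp (v * (K * \<tau>)\<^sup>2 / 2) \<le> exp (16 * K\<^sup>2)" by simp
      have "(K * \<tau>)\<^sup>2 * geom_third s M \<le> (K * \<tau>)\<^sup>2 * (432 / s ^ 4)"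
        by (intro mult_left_mono geom_third_le s) auto
      also have "\<dots> = 432 * K\<^sup>2 / s" 
      proof -
        have "s ^ 4 = s ^ 3 * s" using power_add[of s 3 1] by simp
        then show ?thesis using s by (simp add: power_mult_distrib \<tau>2)
      qed
      finally show "(K * \<tau>)\<^sup>2 * geom_third s M \<le> 432 * K\<^sup>2 / s" .
      have "0 \<le> geom_third s M" unfolding geom_third_def using s by (intro sum_nonneg) auto
      then show "0 \<le> \<bar>geom_mean s M - of_int m\<bar> + (K * \<tau>)\<^sup>2 * geom_third s M" by simp
    qed (use K \<tau> in auto)
    also have "\<dots> = K * exp (16 * K\<^sup>2) * (3 + 432 * K\<^sup>2) * sqrt s"
      using s by (simp add: \<tau>_def field_simps)
    also have "\<dots> \<le> 1/2" using small by (simp only: K_def)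
    finally have "norm (?f t * exp (of_real (v * t\<^sup>2 / 2)) - 1) \<le> 1/2" .
    then have "\<bar>Re (?f t * exp (of_real (v * t\<^sup>2 / 2)) - 1)\<bar> \<le> 1/2"
      using abs_Re_le_cmod order_trans by blast
    moreover have "Re (?f t * exp (of_real (v * t\<^sup>2 / 2)) - 1) = Re (?f t) * exp (v * t\<^sup>2 / 2) - 1"
    proof -
      have "Re (w * of_real x - 1) = Re w * x - 1" for w x by simp
      then show ?thesis by (simp only: exp_of_real)
    qed
    ultimately have "1/2 \<le> Re (?f t) * exp (v * t\<^sup>2 / 2)" by linarith
    then show ?thesis by (simp add: exp_minus field_simps)
  qed
  \<comment> \<open>One minorant for all three ranges: the far bound is subtracted everywhere, and
    its integral is still controlled by the full moment.\<close>
  let ?low = "\<lambda>t. (if t \<in> {-\<tau>..\<tau>} then exp (- 16) / 2 else 0) - ?n t * (1 / (K * \<tau>))"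
  have int1: "((\<lambda>t. if t \<in> {-\<tau>..\<tau>} then exp (- 16) / 2 else 0) has_integral (2 * \<tau> * (exp (- 16) / 2))) {-pi..pi}"
    using has_integral_const_real[of "exp (- 16) / 2 :: real" "-\<tau>" \<tau>] \<tau> \<tau>pi
    by (subst has_integral_restrict) auto
  have "?n integrable_on {-pi..pi}"
    by (intro integrable_continuous_interval continuous_intros continuous_on_geom_char s)
  then have int2: "(?low has_integral (2 * \<tau> * (exp (- 16) / 2) - integral {-pi..pi} ?n * (1 / (K * \<tau>)))) {-pi..pi}"
    by (intro has_integral_diff int1 has_integral_mult_left integrable_integral)
  have int3: "((\<lambda>t. Re (?f t)) has_integral 2 * pi * geom_weight s M m) {-pi..pi}"
    using has_integral_linear[OF geom_char_fourier[OF s(1), of M m] bounded_linear_Re]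
    by (simp only: o_def Re_complex_of_real)
  have "2 * \<tau> * (exp (- 16) / 2) - integral {-pi..pi} ?n * (1 / (K * \<tau>)) \<le> 2 * pi * geom_weight s M m"
  proof (rule has_integral_le[OF int2 int3])
    fix t :: real
    have n0: "0 \<le> ?n t * (1 / (K * \<tau>))" using K \<tau> by simp
    show "?low t \<le> Re (?f t)"
    proof (cases "\<bar>t\<bar> \<le> K * \<tau>")
      case True
      show ?thesis
      proof (cases "t \<in> {-\<tau>..\<tau>}")
        case tin: True
        then have "t\<^sup>2 \<le> \<tau>\<^sup>2" using abs_le_square_iff[of t \<tau>] \<tau> by auto
        then have "v * t\<^sup>2 \<le> 32 / s ^ 3 * s ^ 3" unfolding \<tau>2[symmetric]
          using v v0 s \<tau>2 by (intro mult_mono) auto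
        then have "v * t\<^sup>2 / 2 \<le> 16" using s by simp
        then have "exp (- 16) / 2 \<le> 1/2 * exp (- (v * t\<^sup>2 / 2))" by simp
        moreover have "(if t \<in> {-\<tau>..\<tau>} then exp (- 16) / 2 else 0) = exp (- 16) / (2 :: real)" using tin by simp
        ultimately show ?thesis using near[OF True] n0 by linarith
      next
        case False
        have "0 \<le> 1/2 * exp (- (v * t\<^sup>2 / 2))" by simp
        moreover have "(if t \<in> {-\<tau>..\<tau>} then exp (- 16) / 2 else 0) = (0 :: real)" using False by simp
        ultimately show ?thesis using near[OF True] n0 by linarith
      qed
    next
      case False
      have K1: "1 \<le> K"
        using exp_ge_add_one_self[of "16 :: real"] mult_mono[of 1 "2 * decay_const" 1 "exp 16"]
        by (simp add: K_def window_def decay_const_def)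
      then have "\<tau> \<le> K * \<tau>" using \<tau> by simp
      then have "t \<notin> {-\<tau>..\<tau>}" using False by auto
      then have nin: "(if t \<in> {-\<tau>..\<tau>} then exp (- 16) / 2 else 0) = (0 :: real)" by (rule if_not_P)
      have "norm (geom_char s M (of_real t)) * 1 \<le> norm (geom_char s M (of_real t)) * (\<bar>t\<bar> * (1 / (K * \<tau>)))"
        using False K \<tau> by (intro mult_left_mono) (auto simp: field_simps)
      moreover have "norm (?f t) = norm (geom_char s M (of_real t))" by (simp add: norm_mult)
      ultimately have "norm (?f t) \<le> ?n t * (1 / (K * \<tau>))" by (simp add: mult_ac)
      then show ?thesis using abs_Re_le_cmod[of "?f t"] nin by linarith
    qed
  qed
  moreover have "integral {-pi..pi} ?n * (1 / (K * \<tau>)) \<le> \<tau> * (exp (- 16) / 2)"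
  proof -
    have "integral {-pi..pi} ?n * (1 / (K * \<tau>)) \<le> decay_const * s ^ 3 * (1 / (K * \<tau>))"
      using K \<tau> by (intro mult_right_mono integral_abs_geom_char_le s M) auto
    also have "\<dots> = decay_const * \<tau>\<^sup>2 * (1 / (K * \<tau>))" by (simp only: \<tau>2)
    also have "\<dots> = \<tau> * (decay_const / K)" using \<tau> by (simp add: power2_eq_square)
    also have "decay_const / K = exp (- 16) / 2"
      by (simp add: K_def window_def decay_const_def exp_minus field_simps)
    finally show ?thesis .
  qed
  ultimately have "\<tau> * (exp (- 16) / 2) \<le> 2 * pi * geom_weight s M m" by linarith
  then show ?thesis by (simp add: \<tau>_def mult_ac)
qed

section \<open>Total variation and interlacing\<close>

text \<open>Product rule for differences: in one step the damping drops by a fraction of at most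
  \<open>s\<close>, against a deviation of at most d m, and \<rho> moves by at most
  \<open>d\<close>. Both effects fit under 3 d exp (- s m / 2), whose sum is at most 3 d (1 / s + 2
  / s).\<close>

lemma total_variation_damped:
  fixes \<rho> :: "nat \<Rightarrow> real"
  assumes s: "0 < s" "s \<le> 1" and r0: "\<rho> 0 = 1" and lip: "\<And>m. \<bar>\<rho> (Suc m) - \<rho> m\<bar> \<le> d"
  defines "e \<equiv> (\<lambda>m. exp (- (s * real m)) * (\<rho> m - 1))"
  shows "(\<Sum>m<R. \<bar>e m - e (Suc m)\<bar>) \<le> 9 * d / s"
proof -
  have d: "0 \<le> d" using lip[of 0] by linarith
  have growth: "\<bar>\<rho> m - 1\<bar> \<le> d * real m" for m
  proof (induction m)
    case (Suc m)
    then show ?case using lip[of m] by (simp add: algebra_simps)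
  qed (simp add: r0)
  have term_le: "\<bar>e m - e (Suc m)\<bar> \<le> 3 * d * exp (- (s / 2 * real m))" for m
  proof -
    define x where "x = exp (- (s * real m))"
    define h where "h = exp (s / 2 * real m)"
    have h1: "1 \<le> h" using s by (simp add: h_def)
    have x: "x = 1 / (h * h)" by (simp add: x_def h_def exp_minus exp_add[symmetric] field_simps)
    have "exp (- (s * real (Suc m))) = x * exp (- s)" by (simp add: x_def exp_add[symmetric] algebra_simps)
    then have "e m - e (Suc m) = x * (1 - exp (- s)) * (\<rho> m - 1) + x * exp (- s) * (\<rho> m - \<rho> (Suc m))"
      unfolding e_def x_def[symmetric] by (simp add: algebra_simps)
    also have "\<bar>\<dots>\<bar> \<le> x * s * (d * real m) + x * 1 * d"
    proof (rule order_trans[OF abs_triangle_ineq], rule add_mono)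
      have "0 \<le> 1 - exp (- s)" "1 - exp (- s) \<le> s" using s exp_ge_add_one_self[of "- s"] by auto
      then show "\<bar>x * (1 - exp (- s)) * (\<rho> m - 1)\<bar> \<le> x * s * (d * real m)"
        unfolding abs_mult using growth[of m] by (intro mult_mono) (auto simp: x_def)
      show "\<bar>x * exp (- s) * (\<rho> m - \<rho> (Suc m))\<bar> \<le> x * 1 * d"
        unfolding abs_mult using lip[of m] s d by (intro mult_mono) (auto simp: x_def abs_minus_commute)
    qed
    also have "\<dots> = d * x * (s * real m + 1)" by (simp add: algebra_simps)
    also have "\<dots> \<le> d * x * (3 * h)"
    proof (intro mult_left_mono)
      have "2 * (1 + s / 2 * real m) \<le> 2 * h" unfolding h_def using exp_ge_add_one_self by (intro mult_left_mono) auto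
      then show "s * real m + 1 \<le> 3 * h" using h1 by (simp add: algebra_simps)
    qed (use d in \<open>simp add: x_def\<close>)
    also have "\<dots> = 3 * d * exp (- (s / 2 * real m))"
      using h1 by (simp add: x h_def exp_minus field_simps)
    finally show ?thesis .
  qed
  have "(\<Sum>m<R. \<bar>e m - e (Suc m)\<bar>) \<le> (\<Sum>m<R. 3 * d * exp (- (s / 2 * real m)))"
    by (intro sum_mono term_le)
  also have "\<dots> \<le> (\<Sum>m\<le>R. 3 * d * exp (- (s / 2 * real m)))"
    using d by (intro sum_mono2) auto
  also have "\<dots> = 3 * d * (1 + (\<Sum>m=1..R. exp (- (s / 2 * real m))))"
    unfolding sum_distrib_left[symmetric] sum_atLeast1_atMost sum.atMost_shift by simp
  also have "\<dots> \<le> 3 * d * (1 / s + 1 / (s / 2))"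
    using s d by (intro mult_left_mono add_mono sum_exp_le) auto
  also have "\<dots> = 9 * d / s" by simp
  finally show ?thesis .
qed

lemma Q1_le_Q2: "Q1_nat n l \<le> Q2_nat n l" and Q2_le_Q1: "Q2_nat n l \<le> Q1_nat (Suc n) l"
  by (simp_all add: Q1_nat_def Q2_nat_def algebra_simps)

text \<open>By interlacing, the intervals from \<open>Q1_nat n l\<close> to
  \<open>Q2_nat n l\<close> do not overlap, so a single total variation covers the differences
  across all of them.\<close>

lemma interlaced_sum_le_variation:
  fixes e :: "nat \<Rightarrow> real"
  shows "\<bar>\<Sum>n<K. e (Q1_nat n l) - e (Q2_nat n l)\<bar> \<le> (\<Sum>m<Q1_nat K l. \<bar>e m - e (Suc m)\<bar>)"
proof (induction K)
  case (Suc K)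
  let ?D = "\<lambda>m. \<bar>e m - e (Suc m)\<bar>"
  have "e a - e b = (\<Sum>m=a..<b. e m - e (Suc m))" if "a \<le> b" for a b
    using sum_Suc_diff'[OF that, of "\<lambda>m. - e m"] by simp
  from this[OF Q1_le_Q2[of K l]]
  have "\<bar>e (Q1_nat K l) - e (Q2_nat K l)\<bar> \<le> (\<Sum>m=Q1_nat K l..<Q2_nat K l. ?D m)"
    by (simp only: sum_abs)
  also have "\<dots> \<le> (\<Sum>m=Q1_nat K l..<Q1_nat (Suc K) l. ?D m)"
    using Q2_le_Q1[of K l] by (intro sum_mono2) auto
  finally have "\<bar>\<Sum>n<Suc K. e (Q1_nat n l) - e (Q2_nat n l)\<bar> \<le>
      (\<Sum>m<Q1_nat K l. ?D m) + (\<Sum>m=Q1_nat K l..<Q1_nat (Suc K) l. ?D m)"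
    using Suc by simp
  also have "\<dots> = (\<Sum>m<Q1_nat (Suc K) l. ?D m)"
    using Q1_le_Q2[of K l] Q2_le_Q1[of K l]
    by (simp add: lessThan_atLeast0 sum.atLeastLessThan_concat)
  finally show ?case .
qed simp

section \<open>Comparison with the series \<open>IM\<close>\<close>

text \<open>For N > 0, the solution s of pi^2 / (6 s^2) = N, which puts the mean within O(1 / s) of
  \<open>N\<close>. It is also \<open>Bconst / (2 * sqrt N)\<close>, the rate in
  \<open>IM\<close>.\<close>

definition saddle :: "nat \<Rightarrow> real" where "saddle N = pi / sqrt (6 * real N)"

lemma IM_sums:
  assumes "N > 0"
  shows "(\<lambda>n. exp (- (saddle N * real (Q1_nat n l))) - exp (- (saddle N * real (Q2_nat n l)))) sums IM l N"
proof -
  define s where "s = saddle N"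
  have s: "s > 0" using assms by (simp add: s_def saddle_def)
  have s_eq: "Bconst / (2 * sqrt (real N)) = s"
    by (simp add: Bconst_def s_def saddle_def real_sqrt_mult)
  have 1: "- Bconst * x / (2 * sqrt (real N)) = - (s * x)" for x
    unfolding s_eq[symmetric] by simp
  have "(\<lambda>n. exp (- Bconst * Q1 n l / (2 * sqrt (real N))) - exp (- Bconst * Q2 n l / (2 * sqrt (real N)))) =
     (\<lambda>n. exp (- (s * real (Q1_nat n l))) - exp (- (s * real (Q2_nat n l))))"
  proof -
    have "Q1 n l = real (Q1_nat n l)" "Q2 n l = real (Q2_nat n l)" for n
      by (simp_all add: Q1_def Q2_def Q1_nat_def Q2_nat_def algebra_simps)
    then show ?thesis unfolding 1 by simp
  qed
  moreover have "summable (\<lambda>n. exp (- (s * real (Q1_nat n l))) - exp (- (s * real (Q2_nat n l))))"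
  proof (rule summable_comparison_test')
    show "summable (\<lambda>n. exp (- s) ^ n)" using s by (intro summable_geometric) simp
    fix n assume "n \<ge> (0::nat)"
    have "real (Q1_nat n l) \<le> real (Q2_nat n l)" using Q1_le_Q2 by simp
    then have "exp (- (s * real (Q2_nat n l))) \<le> exp (- (s * real (Q1_nat n l)))" using s by simp
    moreover have "real n \<le> real (Q1_nat n l)" unfolding of_nat_le_iff by (simp add: Q1_nat_def)
    then have "exp (- (s * real (Q1_nat n l))) \<le> exp (- (s * real n))" using s by simp
    moreover have "exp (- (s * real n)) = exp (- s) ^ n" by (simp add: exp_of_nat_mult[symmetric] mult.commute)
    moreover have "0 < exp (- (s * real (Q2_nat n l)))" by simp
    ultimately show "norm (exp (- (s * real (Q1_nat n l))) - exp (- (s * real (Q2_nat n l)))) \<le> exp (- s) ^ n"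
      unfolding real_norm_def by linarith
  qed
  ultimately show ?thesis unfolding IM_def s_def[symmetric] by (simp add: summable_sums)
qed

lemma eventually_truncation:
  fixes s :: real
  assumes "0 < s" shows "eventually (\<lambda>M. 2 * exp (- s) ^ Suc M / (1 - exp (- s)) \<le> 1) sequentially"
proof -
  have "(\<lambda>M. 2 * exp (- s) ^ Suc M / (1 - exp (- s))) \<longlonglongrightarrow> 2 * 0 / (1 - exp (- s))"
    using assms by (intro tendsto_intros LIMSEQ_Suc LIMSEQ_power_zero) auto
  then have "eventually (\<lambda>M. 2 * exp (- s) ^ Suc M / (1 - exp (- s)) < 1) sequentially"
    by (rule order_tendstoD) simp
  then show ?thesis by (rule eventually_mono) simp
qed

text \<open>Ratio of the constants in the Lipschitz bound and in the lower bound for the mass at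
  \<open>N\<close>.\<close>

definition error_const :: real where
  "error_const = decay_const / (exp (- 16) / 2)"

lemma Vd_ratio_error:
  assumes N: "N > 0" and s: "s = saddle N" "s \<le> 1/2"
    and small: "window * exp (16 * window\<^sup>2) * (3 + 432 * window\<^sup>2) * sqrt s \<le> 1/2"
  shows "\<bar>real (Vd (int l) (N + l * (l + 1) div 2)) / real (partition_count N) - IM l N\<bar> \<le> 9 * error_const * sqrt s"
proof -
  have s0: "s > 0" using N s by (simp add: saddle_def)
  have Ns: "real N = pi\<^sup>2 / (6 * s\<^sup>2)" using N by (simp add: s saddle_def power_divide)
  \<comment> \<open>A common \<open>M\<close> for three demands: a small tail, a mean close to
    \<open>N\<close>, and \<open>N \<le> M\<close>, so that the masses up to \<open>N\<close>
    involve unrestricted partition numbers.\<close>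
  have "eventually (\<lambda>M. 2 * exp (- s) ^ Suc M / (1 - exp (- s)) \<le> 1 \<and>
      pi\<^sup>2 / (6 * s\<^sup>2) - 3 / s \<le> geom_mean s M \<and> N \<le> M) sequentially"
    using s0 s by (intro eventually_conj eventually_truncation geom_mean_lower eventually_ge_at_top) auto
  then obtain M where M: "2 * exp (- s) ^ Suc M / (1 - exp (- s)) \<le> 1"
    "pi\<^sup>2 / (6 * s\<^sup>2) - 3 / s \<le> geom_mean s M" "N \<le> M"
    by (auto dest: eventually_happens)
  have mean: "\<bar>geom_mean s M - real_of_int (int N)\<bar> \<le> 3 / s"
  proof -
    have "0 \<le> 3 / s" using s0 by simp
    then show ?thesis using M(2) geom_mean_upper[OF s0, of M] Ns by (simp add: abs_le_iff)
  qed
  define w where "w = geom_weight s M"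
  define \<tau> where "\<tau> = s * sqrt s"
  have \<tau>: "\<tau> > 0" "\<tau> * \<tau> = s ^ 3" using s0 by (auto simp: \<tau>_def power3_eq_cube)
  have lower: "exp (- 16) / 2 * \<tau> \<le> 2 * pi * w (int N)"
    unfolding w_def \<tau>_def by (rule geom_weight_lower[OF s0 s(2) M(1) mean small])
  have "0 < exp (- 16) / 2 * \<tau>" using \<tau> by simp
  then have "0 < 2 * pi * w (int N)" using lower by (rule less_le_trans)
  then have wN: "w (int N) > 0" by (simp add: zero_less_mult_iff)
  define \<rho> where "\<rho> = (\<lambda>m. w (int N - int m) / w (int N))"
  have lip: "\<bar>\<rho> (Suc m) - \<rho> m\<bar> \<le> error_const * \<tau>" for m
  proof -
    have "2 * pi * \<bar>w (int N - int (Suc m)) - w (int N - int m)\<bar> \<le> decay_const * s ^ 3"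
      using geom_weight_lipschitz[OF s0 s(2) M(1), of "int N - int (Suc m)" "int N - int m"] by (simp add: w_def)
    \<comment> \<open>Of the two factors \<tau> of s^3, one is absorbed by the mass at
      \<open>N\<close>; the other stays in the Lipschitz constant of \<rho>.\<close>
    also have "\<dots> = error_const * \<tau> * (exp (- 16) / 2 * \<tau>)"
      unfolding \<tau>(2)[symmetric] by (simp add: error_const_def)
    also have "\<dots> \<le> error_const * \<tau> * (2 * pi * w (int N))"
      using \<tau> by (intro mult_left_mono lower) (auto simp: error_const_def decay_const_def)
    finally have "2 * pi * \<bar>w (int N - int (Suc m)) - w (int N - int m)\<bar> \<le> 2 * pi * (error_const * \<tau> * w (int N))"
      by (simp add: mult_ac)
    then have "\<bar>w (int N - int (Suc m)) - w (int N - int m)\<bar> \<le> error_const * \<tau> * w (int N)"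
      by (subst (asm) mult_le_cancel_left_pos) auto
    moreover have "\<bar>\<rho> (Suc m) - \<rho> m\<bar> = \<bar>w (int N - int (Suc m)) - w (int N - int m)\<bar> / w (int N)"
      unfolding \<rho>_def diff_divide_distrib[symmetric] using wN by (simp add: abs_divide)
    ultimately show ?thesis using wN by (simp add: divide_le_eq)
  qed
  \<comment> \<open>The normalising product cancels in \<rho>; for m > N both sides are 0.\<close>
  have ratio: "of_int (int_partition_count (int N - int m)) / real (partition_count N) = exp (- (s * real m)) * \<rho> m" for m
  proof -
    define G where "G = (\<Prod>k=1..M. 1 - exp (- s * real k))"
    have wj: "w j = of_int (int_partition_count j) * exp (- s * of_int j) * G" if "j \<le> int N" for j
      using that M(3) bounded_partition_count_eq[of "nat j" M]
      by (simp add: w_def geom_weight_def G_def int_partition_count_def)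
    have pN: "int_partition_count (int N) = int (partition_count N)" by (simp add: int_partition_count_def)
    have "G \<noteq> 0" using wN wj[of "int N"] by auto
    then have "\<rho> m = (of_int (int_partition_count (int N - int m)) * exp (- s * of_int (int N - int m))) /
        (real (partition_count N) * exp (- s * real N))"
      using wj[of "int N"] wj[of "int N - int m"] by (simp add: \<rho>_def pN)
    also have "exp (- s * of_int (int N - int m)) = exp (- s * real N) / exp (- (s * real m))"
      by (simp add: exp_diff[symmetric] algebra_simps)
    finally show ?thesis by simp
  qed
  define e where "e = (\<lambda>m. exp (- (s * real m)) * (\<rho> m - 1))"
  define x where "x = (\<lambda>m::nat. exp (- (s * real m)))"
  define B where "B = 9 * (error_const * \<tau>) / s"
  let ?V = "real (Vd (int l) (N + l * (l + 1) div 2)) / real (partition_count N)"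
  \<comment> \<open>The exact formula holds for every \<open>K > N\<close> and \<open>B\<close> does
    not depend on \<open>K\<close>, so \<open>K\<close> may tend to infinity.\<close>
  have bound: "\<bar>?V - (\<Sum>n<K. x (Q1_nat n l) - x (Q2_nat n l))\<bar> \<le> B" if "K > N" for K
  proof -
    have "?V = of_int (int (Vd (int l) (N + l * (l + 1) div 2))) / real (partition_count N)" by simp
    also have "\<dots> = (\<Sum>n<K. x (Q1_nat n l) * \<rho> (Q1_nat n l) - x (Q2_nat n l) * \<rho> (Q2_nat n l))"
      unfolding Vd_expand[OF that] of_int_sum of_int_diff sum_divide_distrib diff_divide_distrib ratio x_def
      by (rule refl)
    finally have "?V - (\<Sum>n<K. x (Q1_nat n l) - x (Q2_nat n l)) = (\<Sum>n<K. e (Q1_nat n l) - e (Q2_nat n l))"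
      by (simp add: sum_subtractf[symmetric] e_def x_def algebra_simps)
    also have "\<bar>\<dots>\<bar> \<le> (\<Sum>m<Q1_nat K l. \<bar>e m - e (Suc m)\<bar>)" by (rule interlaced_sum_le_variation)
    also have "\<dots> \<le> B"
      unfolding e_def B_def using s0 s wN by (intro total_variation_damped lip) (auto simp: \<rho>_def)
    finally show ?thesis .
  qed
  have "(\<lambda>K. \<Sum>n<K. x (Q1_nat n l) - x (Q2_nat n l)) \<longlonglongrightarrow> IM l N"
    using IM_sums[OF N, of l] unfolding sums_def x_def s .
  then have "(\<lambda>K. \<bar>?V - (\<Sum>n<K. x (Q1_nat n l) - x (Q2_nat n l))\<bar>) \<longlonglongrightarrow> \<bar>?V - IM l N\<bar>"
    by (intro tendsto_intros)
  then have "\<bar>?V - IM l N\<bar> \<le> B"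
    by (rule LIMSEQ_le_const2) (use bound in \<open>auto intro!: exI[of _ "Suc N"]\<close>)
  also have "B = 9 * error_const * sqrt s" using s0 by (simp add: B_def \<tau>_def)
  finally show ?thesis .
qed

lemma sqrt_saddle_le:
  assumes "N > 0" shows "sqrt (saddle N) \<le> 2 * real N powr (- 1 / 4)"
proof -
  have "saddle N \<le> 4 / sqrt (real N)"
    unfolding saddle_def using assms pi_less_4 by (intro frac_le) auto
  also have "\<dots> = 4 * real N powr (- 1 / 2)"
  proof -
    have "real N powr (- 1 / 2) = real N powr (- (1 / 2))" by (simp only: minus_divide_left)
    also have "\<dots> = inverse (sqrt (real N))" by (simp only: powr_minus powr_half_sqrt of_nat_0_le_iff)
    finally show ?thesis by (simp only: divide_inverse)
  qed
  also have "\<dots> = (2 * real N powr (- 1 / 4))\<^sup>2"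
  proof -
    have "real N powr (- 1 / 4) * real N powr (- 1 / 4) = real N powr (- 1 / 2)"
      unfolding powr_add[symmetric] by (rule arg_cong[where f = "(powr) (real N)"]) simp
    then show ?thesis by (simp only: power2_eq_square)
  qed
  finally have "sqrt (saddle N) \<le> sqrt ((2 * real N powr (- 1 / 4))\<^sup>2)" by (rule real_sqrt_le_mono)
  then show ?thesis by (simp only: real_sqrt_abs abs_of_nonneg mult_nonneg_nonneg powr_ge_zero zero_le_numeral)
qed

theorem mainTheorem7:
  "\<exists>C N0. \<forall>N l. N \<ge> N0 \<and> real l \<le> sqrt (real N) * (ln (real N))^2 \<longrightarrow>
     \<bar>real (Vd (int l) (N + l * (l + 1) div 2)) / real (partition_count N) - IM l N\<bar>
       \<le> C * real N powr (-1/5)"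
proof -
  define A where "A = window * exp (16 * window\<^sup>2) * (3 + 432 * window\<^sup>2)"
  have lim: "saddle \<longlonglongrightarrow> 0"
  proof -
    have "filterlim (\<lambda>N. sqrt (6 * real N)) at_top sequentially"
      by (intro filterlim_compose[OF sqrt_at_top] filterlim_tendsto_pos_mult_at_top[OF tendsto_const]
          filterlim_real_sequentially) auto
    then show ?thesis unfolding saddle_def[abs_def]
      by (intro real_tendsto_divide_at_top[OF tendsto_const])
  qed
  \<comment> \<open>Since the saddle point tends to 0, the smallness condition of the lower bound
    holds for large \<open>N\<close>.\<close>
  then have "(\<lambda>N. A * sqrt (saddle N)) \<longlonglongrightarrow> A * sqrt 0" by (intro tendsto_intros)
  then have "eventually (\<lambda>N. A * sqrt (saddle N) < 1/2) sequentially" by (rule order_tendstoD) simp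
  moreover have "eventually (\<lambda>N. saddle N < 1/2) sequentially" using lim by (rule order_tendstoD) simp
  ultimately have "eventually (\<lambda>N. A * sqrt (saddle N) < 1/2 \<and> saddle N < 1/2 \<and> N > 0) sequentially"
    using eventually_gt_at_top by (intro eventually_conj)
  then obtain N0 where N0: "\<And>N. N \<ge> N0 \<Longrightarrow> A * sqrt (saddle N) < 1/2 \<and> saddle N < 1/2 \<and> N > 0"
    by (auto simp: eventually_sequentially)
  have "\<bar>real (Vd (int l) (N + l * (l + 1) div 2)) / real (partition_count N) - IM l N\<bar>
       \<le> (18 * error_const) * real N powr (-1/5)" if "N \<ge> N0" for N l
  proof -
    have N: "A * sqrt (saddle N) < 1/2" "saddle N < 1/2" "N > 0" using N0[OF that] by auto
    have "\<bar>real (Vd (int l) (N + l * (l + 1) div 2)) / real (partition_count N) - IM l N\<bar> \<le> 9 * error_const * sqrt (saddle N)"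
      using N by (intro Vd_ratio_error) (auto simp: A_def)
    also have "\<dots> \<le> 9 * error_const * (2 * real N powr (- 1 / 4))"
      using N by (intro mult_left_mono sqrt_saddle_le) (auto simp: error_const_def decay_const_def)
    \<comment> \<open>As N >= 1, the exponent - 1 / 4 obtained so far may be raised to - 1 /
      5.\<close>
    also have "\<dots> \<le> 9 * error_const * (2 * real N powr (- 1 / 5))"
      using N by (intro mult_left_mono powr_mono) (auto simp: error_const_def decay_const_def)
    finally show ?thesis by simp
  qed
  then show ?thesis by blast
qed

end
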